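(* Let $1 < p < \infty$ be given and let $q$ be the conjugate exponent of $p$ (i.e. $1/p+1/q=1$). Then the bilinear form $B \colon C^* \times C \to \mathbb{C}$ uniquely extends to a bounded bilinear form $\tilde{B} \colon M^{*q} \times M^p \to \mathbb{C}$.
   Context: Let $r>0$ and let $n$ be a positive integer. $\mathbb{C}^n$ denotes column vectors, $(\mathbb{C}^n)'$ denotes $n$-dimensional complex row vectors (both with Euclidean norm), $M_n(\mathbb{C})$ the $n\times n$ complex matrices. Let $\eta=(\eta_{ij})\colon [-r,0]\to M_n(\mathbb{C})$ be a function of bounded variation. Integrals against $d\eta$ are Riemann–Stieltjes integrals taken componentwise: for continuous row-valued $\psi$, $\left(\int \psi(\theta)\,d\eta(\theta)\right)_j=\sum_i\int \psi_i(\theta)\,d\eta_{ij}(\theta)$. Write $C=C([-r,0],\mathbb{C}^n)$ and $C^*=C([0,r],(\mathbb{C}^n)')$. The bilinear form $B\colon C^*\times C\to\mathbb{C}$ is $$B(\psi,\phi)=\psi(0)\phi(0)+\int_{-r}^0\left(\int_{-r}^{\xi}\psi(\xi-\theta)\,d\eta(\theta)\right)\phi(\xi)\,d\xi ,$$ where the inner integral, as a function of $\xi\in[-r,0]$, is Riemann integrable. Let $m$ be the sum of the Lebesgue measure on $[-r,0]$ and the Dirac measure at $0$, and let $m^*$ be the sum of the Lebesgue measure on $[0,r]$ and the Dirac measure at $0$. Set $M^p=L^p(([-r,0],m),\mathbb{C}^n)$ and $M^{*q}=L^q(([0,r],m^* ),(\mathbb{C}^n)')$ with their usual $L^p$-,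 $L^q$-norms. $C$ and $C^*$ are regarded as subspaces of $M^p$ and $M^{*q}$ by sending a continuous function to its equivalence class. A bilinear form $b\colon X\times Y\to\mathbb{C}$ on normed spaces is bounded if there is $K>0$ with $|b(x,y)|\le K\|x\|\|y\|$ for all $(x,y) \in X \times Y$. *)

theory Defs
  imports "HOL-Analysis.Analysis" "HOL-Probability.Giry_Monad"
begin

section \<open>Functions of bounded variation and Riemann--Stieltjes integrals\<close>

definition bounded_variation_on :: "real set \<Rightarrow> (real \<Rightarrow> 'a::real_normed_vector) \<Rightarrow> bool" where
  "bounded_variation_on S g \<longleftrightarrow>
     (\<exists>V. \<forall>\<D>. \<D> division_of S \<longrightarrow> (\<Sum>K\<in>\<D>. norm (g (Sup K) - g (Inf K))) \<le> V)"

text \<open>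
  The gauge below is constant, so this is the limit of Riemann--Stieltjes sums
  as the mesh tends to 0, with arbitrary tags (not a Henstock--Kurzweil type integral).
\<close>

definition has_RS_integral ::
    "(real \<Rightarrow> complex) \<Rightarrow> (real \<Rightarrow> complex) \<Rightarrow> complex \<Rightarrow> real \<Rightarrow> real \<Rightarrow> bool" where
  "has_RS_integral f g I a b \<longleftrightarrow>
     (\<forall>\<epsilon>>0. \<exists>\<delta>>0. \<forall>\<D>. \<D> tagged_division_of {a..b} \<and> (\<lambda>x. ball x \<delta>) fine \<D> \<longrightarrow>
        norm ((\<Sum>(x, K)\<in>\<D>. f x * (g (Sup K) - g (Inf K))) - I) < \<epsilon>)"

definition RS_integral ::
    "real \<Rightarrow> real \<Rightarrow> (real \<Rightarrow> complex) \<Rightarrow> (real \<Rightarrow> complex) \<Rightarrow> complex" where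
  "RS_integral a b f g = (THE I. has_RS_integral f g I a b)"

lemma has_RS_integral_unique:
  assumes "has_RS_integral f g I a b" "has_RS_integral f g J a b"
  shows "I = J"
proof (rule ccontr)
  assume "I \<noteq> J"
  define e where "e = norm (I - J) / 2"
  have e: "e > 0" using \<open>I \<noteq> J\<close> by (simp add: e_def)
  let ?S = "\<lambda>\<D>. \<Sum>(x, K)\<in>\<D>. f x * (g (Sup K) - g (Inf K))"
  obtain d1 where d1: "d1 > 0"
    "\<And>\<D>. \<D> tagged_division_of {a..b} \<Longrightarrow> (\<lambda>x. ball x d1) fine \<D> \<Longrightarrow> norm (?S \<D> - I) < e"
    using assms(1) e unfolding has_RS_integral_def by meson
  obtain d2 where d2: "d2 > 0"
    "\<And>\<D>. \<D> tagged_division_of {a..b} \<Longrightarrow> (\<lambda>x. ball x d2) fine \<D> \<Longrightarrow> norm (?S \<D> - J) < e"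
    using assms(2) e unfolding has_RS_integral_def by meson
  have "gauge (\<lambda>x::real. ball x (min d1 d2))"
    using d1(1) d2(1) by (simp add: gauge_def)
  then obtain \<D> where \<D>: "\<D> tagged_division_of cbox a b" "(\<lambda>x. ball x (min d1 d2)) fine \<D>"
    by (rule fine_division_exists)
  have "(\<lambda>x. ball x d1) fine \<D>" "(\<lambda>x. ball x d2) fine \<D>"
    using \<D>(2) by (force simp: fine_def)+
  then have "norm (?S \<D> - I) < e" "norm (?S \<D> - J) < e"
    using d1(2) d2(2) \<D>(1) by auto
  then have "norm (I - J) < e + e"
    using dist_triangle_less_add[of I "?S \<D>" e J e] by (simp add: dist_norm norm_minus_commute)
  then show False by (simp add: e_def)
qed

lemma RS_integral_eq: "has_RS_integral f g I a b \<Longrightarrow> RS_integral a b f g = I"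
  unfolding RS_integral_def by (blast intro: has_RS_integral_unique)

text \<open>Both row and column vectors are elements of \<open>complex^'n\<close>.\<close>

definition RS_integral_row ::
    "real \<Rightarrow> real \<Rightarrow> (real \<Rightarrow> complex^'n) \<Rightarrow> (real \<Rightarrow> complex^'n^'n) \<Rightarrow> complex^'n" where
  "RS_integral_row a b \<psi> \<eta> = (\<chi> j. \<Sum>i\<in>UNIV. RS_integral a b (\<lambda>\<theta>. \<psi> \<theta> $ i) (\<lambda>\<theta>. \<eta> \<theta> $ i $ j))"

definition row_times_col :: "complex^'n \<Rightarrow> complex^'n \<Rightarrow> complex" where
  "row_times_col x y = (\<Sum>i\<in>UNIV. x $ i * y $ i)"


section \<open>The bilinear form on continuous functions\<close>

text \<open>
  A function on a compact interval is represented by a function on the whole real line whose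
  values outside the interval are irrelevant.
\<close>

definition C_space :: "real \<Rightarrow> (real \<Rightarrow> complex^'n) set" where
  "C_space r = {\<phi>. continuous_on {-r..0} \<phi>}"

definition C_star_space :: "real \<Rightarrow> (real \<Rightarrow> complex^'n) set" where
  "C_star_space r = {\<psi>. continuous_on {0..r} \<psi>}"

definition B_form ::
    "real \<Rightarrow> (real \<Rightarrow> complex^'n^'n) \<Rightarrow> (real \<Rightarrow> complex^'n) \<Rightarrow> (real \<Rightarrow> complex^'n) \<Rightarrow> complex" where
  "B_form r \<eta> \<psi> \<phi> =
     row_times_col (\<psi> 0) (\<phi> 0) +
     integral {-r..0} (\<lambda>\<xi>. row_times_col (RS_integral_row (-r) \<xi> (\<lambda>\<theta>. \<psi> (\<xi> - \<theta>)) \<eta>) (\<phi> \<xi>))"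


section \<open>The measures\<close>

definition sum_measure :: "'a measure \<Rightarrow> 'a measure \<Rightarrow> 'a measure" where
  "sum_measure M N = measure_of (space M) (sets M) (\<lambda>A. emeasure M A + emeasure N A)"

lemma space_sum_measure [simp]: "space (sum_measure M N) = space M"
  by (simp add: sum_measure_def)

lemma sets_sum_measure [simp, measurable_cong]: "sets (sum_measure M N) = sets M"
  by (simp add: sum_measure_def)

lemma emeasure_sum_measure:
  assumes "sets N = sets M" "A \<in> sets M"
  shows "emeasure (sum_measure M N) A = emeasure M A + emeasure N A"
proof (rule emeasure_measure_of[OF sum_measure_def])
  show "sets M \<subseteq> Pow (space M)" by (rule sets.space_closed)
  show "A \<in> sets (sum_measure M N)" using assms(2) by simp
  show "positive (sets (sum_measure M N)) (\<lambda>A. emeasure M A + emeasure N A)"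
    by (simp add: positive_def)
  show "countably_additive (sets (sum_measure M N)) (\<lambda>A. emeasure M A + emeasure N A)"
  proof (rule countably_additiveI)
    fix F :: "nat \<Rightarrow> 'a set"
    assume F: "range F \<subseteq> sets (sum_measure M N)" "disjoint_family F"
    have "(\<Sum>i. emeasure M (F i) + emeasure N (F i)) = (\<Sum>i. emeasure M (F i)) + (\<Sum>i. emeasure N (F i))"
      by (simp add: suminf_add[symmetric])
    also have "\<dots> = emeasure M (\<Union>i. F i) + emeasure N (\<Union>i. F i)"
      using F assms(1) by (simp add: suminf_emeasure)
    finally show "(\<Sum>i. emeasure M (F i) + emeasure N (F i)) = emeasure M (\<Union>i. F i) + emeasure N (\<Union>i. F i)" .
  qed
qed

definition leb_dirac :: "real set \<Rightarrow> real measure" where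
  "leb_dirac S = sum_measure (lebesgue_on S) (return (lebesgue_on S) 0)"

definition m_meas :: "real \<Rightarrow> real measure" where
  "m_meas r = leb_dirac {-r..0}"

definition m_star_meas :: "real \<Rightarrow> real measure" where
  "m_star_meas r = leb_dirac {0..r}"


section \<open>Lebesgue spaces of vector-valued functions\<close>

record 'v normed_structure =
  points :: "'v set"
  add :: "'v \<Rightarrow> 'v \<Rightarrow> 'v"
  scale :: "complex \<Rightarrow> 'v \<Rightarrow> 'v"
  nrm :: "'v \<Rightarrow> real"

definition Lp_fun :: "real \<Rightarrow> 'a measure \<Rightarrow> ('a \<Rightarrow> complex^'n) set" where
  "Lp_fun p M = {f \<in> borel_measurable M. integrable M (\<lambda>x. norm (f x) powr p)}"

definition ae_eq :: "real \<Rightarrow> 'a measure \<Rightarrow> (('a \<Rightarrow> complex^'n) \<times> ('a \<Rightarrow> complex^'n)) set" where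
  "ae_eq p M = {(f, g). f \<in> Lp_fun p M \<and> g \<in> Lp_fun p M \<and> (AE x in M. f x = g x)}"

definition Lp_class :: "real \<Rightarrow> 'a measure \<Rightarrow> ('a \<Rightarrow> complex^'n) \<Rightarrow> ('a \<Rightarrow> complex^'n) set" where
  "Lp_class p M f = ae_eq p M `` {f}"

definition rep :: "('a \<Rightarrow> complex^'n) set \<Rightarrow> ('a \<Rightarrow> complex^'n)" where
  "rep X = (SOME f. f \<in> X)"

definition Lp :: "real \<Rightarrow> 'a measure \<Rightarrow> ('a \<Rightarrow> complex^'n) set normed_structure" where
  "Lp p M =
     \<lparr> points = Lp_fun p M // ae_eq p M,
       add = (\<lambda>X Y. Lp_class p M (\<lambda>x. rep X x + rep Y x)),
       scale = (\<lambda>c X. Lp_class p M (\<lambda>x. c *s rep X x)),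
       nrm = (\<lambda>X. (\<integral>x. norm (rep X x) powr p \<partial>M) powr (1 / p)) \<rparr>"

text \<open>The structure does not depend on the representatives chosen by \<^const>\<open>rep\<close>.\<close>

lemma norm_vector_scalar_mult_complex: "norm (c *s (x::complex^'n)) = norm c * norm x"
  by (simp add: norm_vec_def norm_mult L2_set_right_distrib)

lemma Lp_fun_add:
  assumes "p \<ge> 0" "f \<in> Lp_fun p M" "g \<in> Lp_fun p M"
  shows "(\<lambda>x. f x + g x) \<in> Lp_fun p M"
proof -
  have [measurable]: "f \<in> borel_measurable M" "g \<in> borel_measurable M"
    using assms by (auto simp: Lp_fun_def)
  have bound: "norm (u + v) powr p \<le> 2 powr p * (norm u powr p + norm v powr p)" for u v :: "complex^'n"
  proof -
    have "norm (u + v) powr p \<le> (2 * max (norm u) (norm v)) powr p"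
      using norm_triangle_ineq[of u v] by (intro powr_mono2) (use assms in auto)
    also have "\<dots> = 2 powr p * max (norm u) (norm v) powr p"
      by (simp add: powr_mult)
    also have "max (norm u) (norm v) powr p \<le> norm u powr p + norm v powr p"
      by (simp add: max_def)
    finally show ?thesis by simp
  qed
  have "integrable M (\<lambda>x. 2 powr p * (norm (f x) powr p + norm (g x) powr p))"
    using assms by (simp add: Lp_fun_def)
  then have "integrable M (\<lambda>x. norm (f x + g x) powr p)"
    by (rule Bochner_Integration.integrable_bound) (use bound in \<open>auto intro!: AE_I2\<close>)
  then show ?thesis by (simp add: Lp_fun_def)
qed

lemma Lp_fun_scale:
  assumes "f \<in> Lp_fun p M"
  shows "(\<lambda>x. c *s f x) \<in> Lp_fun p M"
proof -
  have [measurable]: "f \<in> borel_measurable M"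
    using assms by (auto simp: Lp_fun_def)
  have "continuous_on UNIV (\<lambda>y::complex^'n. c *s y)"
    unfolding vector_scalar_mult_def by (intro continuous_intros)
  then have "(\<lambda>x. c *s f x) \<in> borel_measurable M"
    by (rule borel_measurable_continuous_on) measurable
  then show ?thesis
    using assms by (simp add: Lp_fun_def norm_vector_scalar_mult_complex powr_mult)
qed

lemma equiv_ae_eq: "equiv (Lp_fun p M) (ae_eq p M)"
  by (rule equivI) (auto simp: ae_eq_def refl_on_def sym_def trans_def elim: AE_mp)

lemma rep_Lp_class:
  assumes "f \<in> Lp_fun p M"
  shows "rep (Lp_class p M f) \<in> Lp_fun p M" "AE x in M. rep (Lp_class p M f) x = f x"
proof -
  have "f \<in> Lp_class p M f"
    using assms by (auto simp: Lp_class_def ae_eq_def)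
  then have "rep (Lp_class p M f) \<in> Lp_class p M f"
    unfolding rep_def by (rule someI[where P = "\<lambda>g. g \<in> Lp_class p M f"])
  then show "rep (Lp_class p M f) \<in> Lp_fun p M" "AE x in M. rep (Lp_class p M f) x = f x"
    by (auto simp: Lp_class_def ae_eq_def elim: AE_mp)
qed

lemma Lp_class_cong:
  assumes "f \<in> Lp_fun p M" "g \<in> Lp_fun p M" "AE x in M. f x = g x"
  shows "Lp_class p M f = Lp_class p M g"
  unfolding Lp_class_def
  by (rule equiv_class_eq[OF equiv_ae_eq]) (use assms in \<open>simp add: ae_eq_def\<close>)

lemma Lp_points: "points (Lp p M) = Lp_class p M ` Lp_fun p M"
  by (auto simp: Lp_def quotient_def Lp_class_def)

lemma Lp_add_class:
  assumes "p \<ge> 0" "f \<in> Lp_fun p M" "g \<in> Lp_fun p M"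
  shows "add (Lp p M) (Lp_class p M f) (Lp_class p M g) = Lp_class p M (\<lambda>x. f x + g x)"
  unfolding Lp_def normed_structure.simps
proof (rule Lp_class_cong)
  show "AE x in M. rep (Lp_class p M f) x + rep (Lp_class p M g) x = f x + g x"
    using rep_Lp_class(2)[OF assms(2)] rep_Lp_class(2)[OF assms(3)] by eventually_elim simp
qed (use assms in \<open>auto intro!: Lp_fun_add rep_Lp_class(1)\<close>)

lemma Lp_scale_class:
  assumes "f \<in> Lp_fun p M"
  shows "scale (Lp p M) c (Lp_class p M f) = Lp_class p M (\<lambda>x. c *s f x)"
  unfolding Lp_def normed_structure.simps
proof (rule Lp_class_cong)
  show "AE x in M. c *s rep (Lp_class p M f) x = c *s f x"
    using rep_Lp_class(2)[OF assms] by eventually_elim simp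
qed (use assms in \<open>auto intro!: Lp_fun_scale rep_Lp_class(1)\<close>)

lemma Lp_nrm_class:
  assumes "f \<in> Lp_fun p M"
  shows "nrm (Lp p M) (Lp_class p M f) = (\<integral>x. norm (f x) powr p \<partial>M) powr (1 / p)"
proof -
  have [measurable]: "rep (Lp_class p M f) \<in> borel_measurable M" "f \<in> borel_measurable M"
    using assms rep_Lp_class(1)[OF assms] by (auto simp: Lp_fun_def)
  have "(\<integral>x. norm (rep (Lp_class p M f) x) powr p \<partial>M) = (\<integral>x. norm (f x) powr p \<partial>M)"
    using rep_Lp_class(2)[OF assms] by (intro integral_cong_AE) (auto elim: AE_mp)
  then show ?thesis by (simp add: Lp_def)
qed


section \<open>Bounded bilinear forms\<close>

definition bilinear_form ::
    "'u normed_structure \<Rightarrow> 'v normed_structure \<Rightarrow> ('u \<times> 'v \<Rightarrow> complex) \<Rightarrow> bool" where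
  "bilinear_form X Y b \<longleftrightarrow>
     (\<forall>x\<in>points X. \<forall>x'\<in>points X. \<forall>y\<in>points Y. b (add X x x', y) = b (x, y) + b (x', y)) \<and>
     (\<forall>c. \<forall>x\<in>points X. \<forall>y\<in>points Y. b (scale X c x, y) = c * b (x, y)) \<and>
     (\<forall>x\<in>points X. \<forall>y\<in>points Y. \<forall>y'\<in>points Y. b (x, add Y y y') = b (x, y) + b (x, y')) \<and>
     (\<forall>c. \<forall>x\<in>points X. \<forall>y\<in>points Y. b (x, scale Y c y) = c * b (x, y))"

definition bounded_form ::
    "'u normed_structure \<Rightarrow> 'v normed_structure \<Rightarrow> ('u \<times> 'v \<Rightarrow> complex) \<Rightarrow> bool" where
  "bounded_form X Y b \<longleftrightarrow>
     (\<exists>K>0. \<forall>x\<in>points X. \<forall>y\<in>points Y. norm (b (x, y)) \<le> K * nrm X x * nrm Y y)"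

definition Mp :: "real \<Rightarrow> real \<Rightarrow> (real \<Rightarrow> complex^'n) set normed_structure" where
  "Mp r p = Lp p (m_meas r)"

definition M_star :: "real \<Rightarrow> real \<Rightarrow> (real \<Rightarrow> complex^'n) set normed_structure" where
  "M_star r q = Lp q (m_star_meas r)"

end

theory Submission
  imports Defs
begin

text \<open>
  The form \<open>B\<close> is defined on continuous functions, which are dense in both Lebesgue spaces. So the
  theorem amounts to the estimate \<open>|B \<psi> \<phi>| \<le> K \<parallel>\<psi>\<parallel>\<^sub>q \<parallel>\<phi>\<parallel>\<^sub>p\<close> for continuous functions: a bilinear form
  with such a bound on dense subspaces extends uniquely by continuity, and the bound also shows that
  \<open>B\<close> only depends on equivalence classes.

  The term \<open>\<psi>(0)\<phi>(0)\<close> is bounded because both measures have a point mass at 0. The integral term is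
  a finite sum of integrals of \<open>F \<phi>\<^sub>j\<close>, where \<open>F \<xi>\<close> is the Stieltjes integral of
  \<open>\<theta> \<mapsto> \<psi>\<^sub>i (\<xi> - \<theta>)\<close> against \<open>g = \<eta>\<^sub>i\<^sub>j\<close> over \<open>[-r, \<xi>]\<close>. Interchanging the two integrations, every
  \<open>\<theta>\<close> contributes the integral of a translate of \<open>\<psi>\<^sub>i\<close> times \<open>\<phi>\<^sub>j\<close>, which Hoelder's inequality bounds
  by the product of the norms independently of \<open>\<theta>\<close>; the total is at most the variation of \<open>g\<close> times
  that product. The lemma \<open>RS_convolution_bound\<close> carries this out on Riemann--Stieltjes sums, where
  the interchange is one of a finite sum and an integral. An increasing function \<open>V\<close> whose increments
  dominate those of \<open>\<eta>\<close> keeps track of the variation. For bilinearity of \<open>B\<close> it is essential that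
  all the integrals exist: the Stieltjes integrals exist by integration by parts and uniform
  approximation by polynomials (\<open>has_RS_integral_continuous\<close>), and \<open>F\<close> is measurable as a limit of
  its Riemann--Stieltjes sums.

  Density is \<open>Lp_dense_continuous\<close>; the only point beyond Lebesgue measure is that the approximating
  functions have to match the value at 0. The extension principle is \<open>unique_extension\<close>.
\<close>

section \<open>Functions of bounded variation and a variation function\<close>

text \<open>
  \<open>V\<close> stands for the total variation function \<open>x \<mapsto> Var(g; [a, x])\<close>, or any function with
  larger increments: all that later arguments use of bounded variation is that the increments of \<open>V\<close> dominate those of \<open>g\<close>.
  Unlike a numerical bound on the variation, such a \<open>V\<close> restricts to subintervals, and
  the sum of its increments over a partition telescopes.
\<close>

definition variation_bound :: "(real \<Rightarrow> real) \<Rightarrow> (real \<Rightarrow> 'a::real_normed_vector) \<Rightarrow> real \<Rightarrow> real \<Rightarrow> bool" where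
  "variation_bound V g a b \<longleftrightarrow>
     (\<forall>x y. a \<le> x \<longrightarrow> x \<le> y \<longrightarrow> y \<le> b \<longrightarrow> norm (g y - g x) \<le> V y - V x)"

lemma variation_boundD:
  "variation_bound V g a b \<Longrightarrow> a \<le> x \<Longrightarrow> x \<le> y \<Longrightarrow> y \<le> b \<Longrightarrow> norm (g y - g x) \<le> V y - V x"
  by (simp add: variation_bound_def)

lemma variation_bound_mono:
  "variation_bound V g a b \<Longrightarrow> a \<le> x \<Longrightarrow> x \<le> y \<Longrightarrow> y \<le> b \<Longrightarrow> V x \<le> V y"
  using variation_boundD[of V g a b x y] norm_ge_zero[of "g y - g x"] by linarith

lemma variation_bound_subinterval:
  "variation_bound V g a b \<Longrightarrow> a \<le> c \<Longrightarrow> d \<le> b \<Longrightarrow> variation_bound V g c d"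
  by (auto simp: variation_bound_def)

text \<open>
  \<open>V x\<close> is the supremum \<open>Sup (T x)\<close> of the sums over divisions of \<open>[a, x]\<close>. Appending the
  interval \<open>[x, y]\<close> to a division of \<open>[a, x]\<close> gives a division of \<open>[a, y]\<close>, hence
  \<open>V x + norm (g y - g x) \<le> V y\<close>.
\<close>

lemma bounded_variation_imp_variation_bound:
  fixes g :: "real \<Rightarrow> 'a::real_normed_vector"
  assumes "bounded_variation_on {a..b} g"
  shows "\<exists>V. variation_bound V g a b"
proof -
  let ?s = "\<lambda>\<D>. \<Sum>K\<in>\<D>. norm (g (Sup K) - g (Inf K))"
  define T where "T x = ?s ` {\<D>. \<D> division_of {a..x}}" for x
  obtain C where C: "\<And>\<D>. \<D> division_of {a..b} \<Longrightarrow> ?s \<D> \<le> C"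
    using assms by (auto simp: bounded_variation_on_def)
  have ext: "s + norm (g y - g x) \<in> T y" if "a \<le> x" "x \<le> y" and sT: "s \<in> T x" for x y s
  proof -
    obtain \<D> where \<D>: "\<D> division_of {a..x}" and s: "s = ?s \<D>"
      using sT by (auto simp: T_def)
    have "insert {x..y} \<D> division_of {a..y}"
    proof -
      have "{{x..y}} division_of {x..y}"
        using division_of_self[of x y] that(2) by simp
      moreover have "interior {x..y} \<inter> interior {a..x} = {}"
        by auto
      ultimately have "{{x..y}} \<union> \<D> division_of {x..y} \<union> {a..x}"
        using \<D> by (intro division_disjoint_union)
      moreover have "{x..y} \<union> {a..x} = {a..y}"
        using that by auto
      ultimately show ?thesis by simp
    qed
    \<comment> \<open>If the new interval already belongs to the division, it is degenerate and contributes 0,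
      so inserting it changes nothing in that case.\<close>
    moreover have "?s (insert {x..y} \<D>) = s + norm (g y - g x)"
    proof (cases "{x..y} \<in> \<D>")
      case True
      then have "{x..y} \<subseteq> {a..x}"
        using \<D> by blast
      then have "y = x" using that by auto
      then show ?thesis using True s by (simp add: insert_absorb)
    next
      case False
      then show ?thesis
        using \<D> s that(2) by (simp add: division_of_finite)
    qed
    ultimately show ?thesis
      unfolding T_def by (intro image_eqI[of _ _ "insert {x..y} \<D>"]) (simp_all only: mem_Collect_eq)
  qed
  have bdd: "bdd_above (T x)" if "a \<le> x" "x \<le> b" for x
  proof (rule bdd_aboveI)
    fix s assume "s \<in> T x"
    then have "s + norm (g b - g x) \<in> T b"
      by (rule ext[OF that])
    then have "s + norm (g b - g x) \<le> C"
      using C unfolding T_def by (elim imageE) (simp only: mem_Collect_eq)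
    then show "s \<le> C"
      using norm_ge_zero[of "g b - g x"] by linarith
  qed
  have "variation_bound (\<lambda>x. Sup (T x)) g a b"
    unfolding variation_bound_def
  proof (intro allI impI)
    fix x y assume xy: "a \<le> x" "x \<le> y" "y \<le> b"
    have "{{a..x}} division_of {a..x}"
      using division_of_self[of a x] xy by simp
    then have "T x \<noteq> {}" by (auto simp: T_def)
    moreover have "s \<le> Sup (T y) - norm (g y - g x)" if "s \<in> T x" for s
      using cSup_upper[OF ext[OF xy(1,2) that] bdd] xy by simp
    ultimately have "Sup (T x) \<le> Sup (T y) - norm (g y - g x)"
      by (rule cSup_least)
    then show "norm (g y - g x) \<le> Sup (T y) - Sup (T x)" by simp
  qed
  then show ?thesis by blast
qed

text \<open>
  The real and imaginary parts of \<open>g\<close> are differences of the increasing functions \<open>V\<close> and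
  \<open>V - Re g\<close>, respectively \<open>V\<close> and \<open>V - Im g\<close>. Clamping the argument to \<open>[a, b]\<close> makes
  these functions increasing on the whole line.
\<close>

lemma variation_bound_borel_measurable:
  fixes g :: "real \<Rightarrow> complex"
  assumes V: "variation_bound V g a b" and "a \<le> b"
  shows "(\<lambda>x. g (max a (min b x))) \<in> borel_measurable borel"
proof -
  let ?c = "\<lambda>x. max a (min b x)"
  have diff: "norm (g (?c y) - g (?c x)) \<le> V (?c y) - V (?c x)" if "x \<le> y" for x y
    by (rule variation_boundD[OF V]) (use that assms(2) in auto)
  have "V (?c x) \<le> V (?c y)" if "x \<le> y" for x y
    using diff[OF that] norm_ge_zero[of "g (?c y) - g (?c x)"] by linarith
  then have V_meas: "(\<lambda>x. V (?c x)) \<in> borel_measurable borel"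
    by (intro borel_measurable_mono monoI)
  have part: "(\<lambda>x. h (g (?c x))) \<in> borel_measurable borel"
    if h: "\<And>z w. h z - h w \<le> norm (z - w)" for h :: "complex \<Rightarrow> real"
  proof -
    have "V (?c x) - h (g (?c x)) \<le> V (?c y) - h (g (?c y))" if "x \<le> y" for x y
      using diff[OF that] h[of "g (?c y)" "g (?c x)"] by linarith
    then have "(\<lambda>x. V (?c x) - h (g (?c x))) \<in> borel_measurable borel"
      by (intro borel_measurable_mono monoI)
    then have "(\<lambda>x. V (?c x) - (V (?c x) - h (g (?c x)))) \<in> borel_measurable borel"
      using V_meas by (rule borel_measurable_diff[rotated])
    then show ?thesis by simp
  qed
  have "Re z - Re w \<le> norm (z - w)" "Im z - Im w \<le> norm (z - w)" for z w
    using abs_Re_le_cmod[of "z - w"] abs_Im_le_cmod[of "z - w"] by auto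
  then have "(\<lambda>x. Re (g (?c x))) \<in> borel_measurable borel" "(\<lambda>x. Im (g (?c x))) \<in> borel_measurable borel"
    by (auto intro: part)
  then show ?thesis
    by (simp add: borel_measurable_complex_iff)
qed

section \<open>Riemann--Stieltjes integrals of continuous functions\<close>

lemma tagged_division_of_intervalE:
  fixes a b :: real
  assumes "\<D> tagged_division_of {a..b}" "(x, K) \<in> \<D>"
  obtains u v where "K = {u..v}" "a \<le> u" "u \<le> x" "x \<le> v" "v \<le> b"
proof -
  obtain u v where K: "K = cbox u v"
    using tagged_division_ofD(4)[OF assms] by blast
  have "x \<in> K" "K \<subseteq> {a..b}"
    using tagged_division_ofD(2,3)[OF assms] by auto
  then show thesis
    using K that[of u v] by auto
qed

text \<open>
  The estimate behind every bound on Riemann--Stieltjes sums: an error of at most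
  \<open>e \<cdot> (V v - V u)\<close> on each subinterval telescopes to \<open>e \<cdot> (V b - V a)\<close>.
\<close>

lemma RS_sum_norm_le:
  fixes F :: "real \<Rightarrow> real set \<Rightarrow> complex"
  assumes V: "\<D> tagged_division_of {a..b}" "a \<le> b"
    and F: "\<And>x u v. (x, {u..v}) \<in> \<D> \<Longrightarrow> a \<le> u \<Longrightarrow> u \<le> x \<Longrightarrow> x \<le> v \<Longrightarrow> v \<le> b
              \<Longrightarrow> norm (F x {u..v}) \<le> e * (V v - V u)"
  shows "norm (\<Sum>(x, K)\<in>\<D>. F x K) \<le> e * (V b - V a :: real)"
proof -
  have "norm (\<Sum>(x, K)\<in>\<D>. F x K) \<le> (\<Sum>(x, K)\<in>\<D>. e * (V (Sup K) - V (Inf K)))"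
  proof (rule sum_norm_le, clarify)
    fix x K assume xK: "(x, K) \<in> \<D>"
    with V(1) obtain u v where "K = {u..v}" "a \<le> u" "u \<le> x" "x \<le> v" "v \<le> b"
      by (rule tagged_division_of_intervalE)
    then show "norm (F x K) \<le> e * (V (Sup K) - V (Inf K))"
      using F xK by auto
  qed
  also have "\<dots> = e * (\<Sum>(x, K)\<in>\<D>. V (Sup K) - V (Inf K))"
    by (simp add: sum_distrib_left case_prod_unfold)
  also have "(\<Sum>(x, K)\<in>\<D>. V (Sup K) - V (Inf K)) = V b - V a"
    using V by (intro additive_tagged_division_1)
  finally show ?thesis .
qed

text \<open>
  For continuously differentiable \<open>f\<close>, integration by parts reduces the Stieltjes integral to the
  ordinary integral of \<open>f' g\<close>: its value is \<open>G b - G a\<close> with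
  \<open>G x = f x g x - \<integral> f' g\<close> over \<open>[a, x]\<close>.
  On a subinterval of length \<open>h\<close> with end points \<open>u\<close>, \<open>v\<close>, a term of the Riemann--Stieltjes sum
  differs from \<open>G v - G u\<close> by at most \<open>2 M h (V v - V u)\<close> when \<open>M\<close> bounds \<open>f'\<close>, and these
  errors add up to a quantity that vanishes with the mesh.
\<close>

lemma has_RS_integral_C1:
  fixes f f' g :: "real \<Rightarrow> complex"
  assumes V: "variation_bound V g a b" and ab: "a \<le> b"
    and f': "\<And>x. (f has_vector_derivative f' x) (at x)"
    and cont: "continuous_on {a..b} f'"
  shows "\<exists>I. has_RS_integral f g I a b"
proof -
  have meas_g: "(\<lambda>x. g (max a (min b x))) \<in> borel_measurable lebesgue"
    using variation_bound_borel_measurable[OF V ab] by (intro measurable_completion) simp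
  have "bounded (f' ` {a..b})"
    using cont by (intro compact_imp_bounded compact_continuous_image) auto
  then obtain M where M: "M > 0" "\<And>x. x \<in> {a..b} \<Longrightarrow> norm (f' x) \<le> M"
    by (auto simp: bounded_pos)
  have gb: "norm (g x - g b) \<le> V b - V a" if "x \<in> {a..b}" for x
    using variation_boundD[OF V, of x b] variation_bound_mono[OF V, of a x] that
    by (simp add: norm_minus_commute)
  have int: "(\<lambda>x. f' x * g x) integrable_on {u..v}" if uv: "a \<le> u" "v \<le> b" for u v
  proof -
    have "(\<lambda>x. f' x * g x) integrable_on {a..b}"
    proof (rule measurable_bounded_by_integrable_imp_integrable)
      have "(\<lambda>x. f' x * g (max a (min b x))) \<in> borel_measurable (lebesgue_on {a..b})"
        using continuous_imp_measurable_on_sets_lebesgue[OF cont] meas_g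
        by (intro borel_measurable_times) (auto intro: measurable_restrict_space1)
      then show "(\<lambda>x. f' x * g x) \<in> borel_measurable (lebesgue_on {a..b})"
        by (rule measurable_cong[THEN iffD1, rotated]) (auto simp: min_def max_def)
      show "(\<lambda>x. M * (V b - V a + norm (g b))) integrable_on {a..b}"
        by (intro integrable_const_ivl)
      fix x assume x: "x \<in> {a..b}"
      have "norm (g x) \<le> norm (g x - g b) + norm (g b)"
        using norm_triangle_ineq[of "g x - g b" "g b"] by simp
      with gb[OF x] have "norm (g x) \<le> V b - V a + norm (g b)" by linarith
      then show "norm (f' x * g x) \<le> M * (V b - V a + norm (g b))"
        unfolding norm_mult using M x by (intro mult_mono) auto
    qed auto
    then show ?thesis
      by (rule integrable_on_subinterval) (use uv in auto)
  qed
  define G where "G x = f x * g x - integral {a..x} (\<lambda>x. f' x * g x)" for x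
  define W where "W = V b - V a"
  have W: "W \<ge> 0"
    using variation_bound_mono[OF V] ab by (simp add: W_def)
  have FTC: "(f' has_integral f v - f u) {u..v}" if "u \<le> v" for u v
    using that f' by (intro fundamental_theorem_of_calculus) (auto intro: has_vector_derivative_at_within)
  have key: "norm (f x * (g v - g u) - (G v - G u)) \<le> 2 * M * (v - u) * (V v - V u)"
    if uv: "a \<le> u" "u \<le> x" "x \<le> v" "v \<le> b" for u v x
  proof -
    have "norm (f x - f u) \<le> M * (v - u)"
    proof -
      have "norm (f x - f u) \<le> M * measure lborel (cbox u x)"
        by (rule has_integral_bound[where f = f']) (use FTC M uv in auto)
      also have "\<dots> \<le> M * (v - u)"
        using uv M by (auto intro!: mult_left_mono)
      finally show ?thesis .
    qed
    moreover have "norm (g v - g u) \<le> V v - V u"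
      by (rule variation_boundD[OF V]) (use uv in auto)
    ultimately have 1: "norm ((f x - f u) * (g v - g u)) \<le> M * (v - u) * (V v - V u)"
      using uv M by (auto simp: norm_mult intro!: mult_mono)
    have "((\<lambda>t. f' t * g t - f' t * g v) has_integral
             integral {u..v} (\<lambda>x. f' x * g x) - (f v - f u) * g v) {u..v}"
      using int[of u v] FTC[of u v] uv
      by (intro has_integral_diff has_integral_mult_left integrable_integral) auto
    then have 2: "norm (integral {u..v} (\<lambda>x. f' x * g x) - (f v - f u) * g v)
        \<le> M * (V v - V u) * measure lborel (cbox u v)"
      unfolding cbox_interval[symmetric]
    proof (rule has_integral_bound[rotated])
      show "0 \<le> M * (V v - V u)"
        using M variation_bound_mono[OF V, of u v] uv by simp
      fix t assume "t \<in> cbox u v"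
      then have t: "t \<in> {u..v}" by simp
      have "norm (g t - g v) \<le> V v - V u"
        using variation_boundD[OF V, of t v] variation_bound_mono[OF V, of u t] t uv
        by (simp add: norm_minus_commute)
      then have "norm (f' t * (g t - g v)) \<le> M * (V v - V u)"
        using M t uv by (auto simp: norm_mult intro!: mult_mono)
      then show "norm (f' t * g t - f' t * g v) \<le> M * (V v - V u)"
        by (simp add: algebra_simps)
    qed
    have "integral {a..v} (\<lambda>x. f' x * g x)
        = integral {a..u} (\<lambda>x. f' x * g x) + integral {u..v} (\<lambda>x. f' x * g x)"
      using uv int by (intro Henstock_Kurzweil_Integration.integral_combine[symmetric]) auto
    then have "f x * (g v - g u) - (G v - G u)
        = (f x - f u) * (g v - g u) + (integral {u..v} (\<lambda>x. f' x * g x) - (f v - f u) * g v)"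
      by (simp add: G_def algebra_simps)
    also have "norm \<dots> \<le> M * (v - u) * (V v - V u) + M * (V v - V u) * measure lborel (cbox u v)"
      by (rule norm_triangle_le[OF add_mono[OF 1 2]])
    also have "\<dots> = 2 * M * (v - u) * (V v - V u)"
      using uv by simp
    finally show ?thesis .
  qed
  have "has_RS_integral f g (G b - G a) a b"
    unfolding has_RS_integral_def
  proof (intro allI impI)
    fix \<epsilon> :: real assume \<epsilon>: "\<epsilon> > 0"
    \<comment> \<open>An interval inside a ball of radius \<open>\<delta>\<close> is at most \<open>2\<delta>\<close> long, which turns the factor 2 of
      the local estimate into 4; the summand 1 avoids a division by 0.\<close>
    define \<delta> where "\<delta> = \<epsilon> / (4 * M * W + 1)"
    have pos: "4 * M * W + 1 > 0" using W M by (intro add_nonneg_pos) auto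
    then have "\<delta> > 0" using \<epsilon> by (simp add: \<delta>_def)
    have "\<delta> * (4 * M * W + 1) = \<epsilon>" using pos by (simp add: \<delta>_def)
    then have \<delta>: "4 * M * \<delta> * W < \<epsilon>"
      using \<open>\<delta> > 0\<close> by (simp add: algebra_simps)
    show "\<exists>\<delta>>0. \<forall>\<D>. \<D> tagged_division_of {a..b} \<and> (\<lambda>x. ball x \<delta>) fine \<D> \<longrightarrow>
        norm ((\<Sum>(x, K)\<in>\<D>. f x * (g (Sup K) - g (Inf K))) - (G b - G a)) < \<epsilon>"
    proof (intro exI[of _ \<delta>] conjI allI impI \<open>\<delta> > 0\<close>)
      fix \<D> assume D: "\<D> tagged_division_of {a..b} \<and> (\<lambda>x. ball x \<delta>) fine \<D>"
      have "norm (\<Sum>(x, K)\<in>\<D>. f x * (g (Sup K) - g (Inf K)) - (G (Sup K) - G (Inf K))) \<le> (4 * M * \<delta>) * (V b - V a)"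
      proof (rule RS_sum_norm_le[OF _ ab])
        fix x u v assume uv: "(x, {u..v}) \<in> \<D>" "a \<le> u" "u \<le> x" "x \<le> v" "v \<le> b"
        have "{u..v} \<subseteq> ball x \<delta>" using D uv(1) by (auto simp: fine_def)
        then have "u \<in> ball x \<delta>" "v \<in> ball x \<delta>" using uv by (meson atLeastAtMost_iff order.trans order_refl subsetD)+
        then have "v - u \<le> 2 * \<delta>" by (auto simp: dist_real_def)
        then have "2 * M * (v - u) * (V v - V u) \<le> 2 * M * (2 * \<delta>) * (V v - V u)"
          using M variation_bound_mono[OF V, of u v] uv
          by (intro mult_right_mono mult_left_mono) auto
        with key[of u x v] uv
        show "norm (f x * (g (Sup {u..v}) - g (Inf {u..v})) - (G (Sup {u..v}) - G (Inf {u..v}))) \<le> 4 * M * \<delta> * (V v - V u)"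
          by simp
      qed (use D in auto)
      also have "(\<Sum>(x, K)\<in>\<D>. f x * (g (Sup K) - g (Inf K)) - (G (Sup K) - G (Inf K)))
          = (\<Sum>(x, K)\<in>\<D>. f x * (g (Sup K) - g (Inf K))) - (\<Sum>(x, K)\<in>\<D>. G (Sup K) - G (Inf K))"
        by (simp add: case_prod_unfold sum_subtractf)
      also have "(\<Sum>(x, K)\<in>\<D>. G (Sup K) - G (Inf K)) = G b - G a"
        using D ab by (intro additive_tagged_division_1) auto
      finally show "norm ((\<Sum>(x, K)\<in>\<D>. f x * (g (Sup K) - g (Inf K))) - (G b - G a)) < \<epsilon>"
        using \<delta> by (simp add: W_def)
    qed
  qed
  then show ?thesis ..
qed

lemma RS_sum_diff_le:
  fixes f g h :: "real \<Rightarrow> complex"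
  assumes V: "variation_bound V g a b" and "a \<le> b" and "\<D> tagged_division_of {a..b}"
    and fh: "\<And>x. x \<in> {a..b} \<Longrightarrow> norm (f x - h x) \<le> e"
  shows "norm ((\<Sum>(x, K)\<in>\<D>. f x * (g (Sup K) - g (Inf K))) - (\<Sum>(x, K)\<in>\<D>. h x * (g (Sup K) - g (Inf K))))
     \<le> e * (V b - V a :: real)"
proof -
  have "(\<Sum>(x, K)\<in>\<D>. f x * (g (Sup K) - g (Inf K))) - (\<Sum>(x, K)\<in>\<D>. h x * (g (Sup K) - g (Inf K)))
      = (\<Sum>(x, K)\<in>\<D>. (f x - h x) * (g (Sup K) - g (Inf K)))"
    unfolding sum_subtractf[symmetric] by (intro sum.cong) (auto simp: algebra_simps)
  also have "norm \<dots> \<le> e * (V b - V a)"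
  proof (rule RS_sum_norm_le[OF assms(3,2)])
    fix x u v assume uv: "a \<le> u" "u \<le> x" "x \<le> v" "v \<le> b"
    have "norm (f x - h x) * norm (g v - g u) \<le> e * (V v - V u)"
      using uv fh[of x] variation_boundD[OF V, of u v]
        order_trans[OF norm_ge_zero fh[of x]] by (intro mult_mono) auto
    then show "norm ((f x - h x) * (g (Sup {u..v}) - g (Inf {u..v}))) \<le> e * (V v - V u)"
      using uv by (simp add: norm_mult)
  qed
  finally show ?thesis .
qed

lemma has_RS_integral_diff_le:
  assumes V: "variation_bound V g a b" and "a \<le> b"
    and I: "has_RS_integral f g I a b" and J: "has_RS_integral h g J a b"
    and fh: "\<And>x. x \<in> {a..b} \<Longrightarrow> norm (f x - h x) \<le> e"
  shows "norm (I - J) \<le> e * (V b - V a)"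
proof (rule field_le_epsilon)
  fix \<epsilon> :: real assume "\<epsilon> > 0"
  then have "\<epsilon> / 2 > 0" by simp
  let ?S = "\<lambda>f \<D>. \<Sum>(x, K)\<in>\<D>. f x * (g (Sup K) - g (Inf K))"
  obtain d1 where d1: "d1 > 0"
    "\<And>\<D>. \<D> tagged_division_of {a..b} \<Longrightarrow> (\<lambda>x. ball x d1) fine \<D> \<Longrightarrow> norm (?S f \<D> - I) < \<epsilon> / 2"
    using I \<open>\<epsilon> / 2 > 0\<close> unfolding has_RS_integral_def by meson
  obtain d2 where d2: "d2 > 0"
    "\<And>\<D>. \<D> tagged_division_of {a..b} \<Longrightarrow> (\<lambda>x. ball x d2) fine \<D> \<Longrightarrow> norm (?S h \<D> - J) < \<epsilon> / 2"
    using J \<open>\<epsilon> / 2 > 0\<close> unfolding has_RS_integral_def by meson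
  have "gauge (\<lambda>x::real. ball x (min d1 d2))"
    using d1(1) d2(1) by (simp add: gauge_def)
  then obtain \<D> where \<D>: "\<D> tagged_division_of {a..b}" "(\<lambda>x. ball x (min d1 d2)) fine \<D>"
    using fine_division_exists[of "\<lambda>x::real. ball x (min d1 d2)" a b] by auto
  have "(\<lambda>x. ball x d1) fine \<D>" "(\<lambda>x. ball x d2) fine \<D>"
    using \<D>(2) by (force simp: fine_def)+
  then have "norm (?S f \<D> - I) < \<epsilon> / 2" "norm (?S h \<D> - J) < \<epsilon> / 2"
    using d1 d2 \<D>(1) by auto
  moreover have "norm (?S f \<D> - ?S h \<D>) \<le> e * (V b - V a)"
    using assms \<D>(1) by (intro RS_sum_diff_le) auto
  moreover have "norm (I - J) \<le> norm (?S f \<D> - I) + norm (?S f \<D> - ?S h \<D>) + norm (?S h \<D> - J)"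
  proof -
    have "I - J = (?S f \<D> - ?S h \<D>) + (?S h \<D> - J) - (?S f \<D> - I)" by simp
    then show ?thesis
      using norm_triangle_ineq4[of "(?S f \<D> - ?S h \<D>) + (?S h \<D> - J)" "?S f \<D> - I"]
        norm_triangle_ineq[of "?S f \<D> - ?S h \<D>" "?S h \<D> - J"] by simp
  qed
  ultimately show "norm (I - J) \<le> e * (V b - V a) + \<epsilon>" by linarith
qed

text \<open>
  Polynomials have Riemann--Stieltjes integrals by integration by parts, and they are dense among
  the continuous functions. Replacing the integrand by one at distance \<open>e\<close> changes every
  Riemann--Stieltjes sum by at most \<open>e (V b - V a)\<close>, uniformly in the tagged division. Hence
  existence of the integral passes to uniform limits.
\<close>

lemma has_RS_integral_continuous:
  fixes f g :: "real \<Rightarrow> complex"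
  assumes V: "variation_bound V g a b" and ab: "a \<le> b" and cont: "continuous_on {a..b} f"
  shows "\<exists>I. has_RS_integral f g I a b"
proof -
  define W where "W = V b - V a"
  have W: "W \<ge> 0"
    using variation_bound_mono[OF V] ab by (simp add: W_def)
  have "\<exists>h. polynomial_function h \<and> (\<forall>x\<in>{a..b}. norm (f x - h x) < inverse (real (Suc n)))" for n
    by (rule Stone_Weierstrass_polynomial_function) (use cont in auto)
  then obtain h where h: "\<And>n. polynomial_function (h n)"
      "\<And>n x. x \<in> {a..b} \<Longrightarrow> norm (f x - h n x) < inverse (real (Suc n))"
    by metis
  have "\<exists>I. has_RS_integral (h n) g I a b" for n
  proof -
    obtain h' where "polynomial_function h'" "\<And>x. (h n has_vector_derivative h' x) (at x)"
      using has_vector_derivative_polynomial_function[OF h(1)] by metis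
    then show ?thesis
      by (intro has_RS_integral_C1[OF V ab]) (auto intro: continuous_on_polymonial_function)
  qed
  then obtain I where I: "\<And>n. has_RS_integral (h n) g (I n) a b" by metis
  have small: "\<exists>N. \<forall>n\<ge>N. inverse (real (Suc n)) * W < e" if "e > 0" for e
  proof -
    have "(\<lambda>n. inverse (real (Suc n)) * W) \<longlonglongrightarrow> 0 * W"
      by (intro tendsto_mult LIMSEQ_inverse_real_of_nat tendsto_const)
    then have "\<forall>\<^sub>F n in sequentially. inverse (real (Suc n)) * W < e"
      using that by (intro order_tendstoD) auto
    then show ?thesis by (simp add: eventually_sequentially)
  qed
  have "Cauchy I"
  proof (rule CauchyI)
    fix e :: real assume "e > 0"
    then obtain N where N: "\<And>n. n \<ge> N \<Longrightarrow> inverse (real (Suc n)) * W < e / 2"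
      using small[of "e / 2"] by auto
    have "norm (I m - I n) < e" if "m \<ge> N" "n \<ge> N" for m n
    proof -
      have "norm (I m - I n) \<le> (inverse (real (Suc m)) + inverse (real (Suc n))) * (V b - V a)"
      proof (rule has_RS_integral_diff_le[OF V ab I I])
        fix x assume x: "x \<in> {a..b}"
        have "norm (h m x - h n x) \<le> norm (f x - h m x) + norm (f x - h n x)"
          using norm_triangle_ineq4[of "f x - h n x" "f x - h m x"] by simp
        with h(2)[OF x, of m] h(2)[OF x, of n]
        show "norm (h m x - h n x) \<le> inverse (real (Suc m)) + inverse (real (Suc n))"
          by linarith
      qed
      with N[OF that(1)] N[OF that(2)] show ?thesis
        by (simp add: W_def algebra_simps)
    qed
    then show "\<exists>N. \<forall>m\<ge>N. \<forall>n\<ge>N. norm (I m - I n) < e" by blast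
  qed
  then obtain L where L: "I \<longlonglongrightarrow> L"
    using Cauchy_convergent convergent_def by blast
  have "has_RS_integral f g L a b"
    unfolding has_RS_integral_def
  proof (intro allI impI)
    fix \<epsilon> :: real assume "\<epsilon> > 0"
    then have e3: "\<epsilon> / 3 > 0" by simp
    obtain N1 where N1: "\<And>n. n \<ge> N1 \<Longrightarrow> inverse (real (Suc n)) * W < \<epsilon> / 3"
      using small[OF e3] by auto
    obtain N2 where N2: "\<And>n. n \<ge> N2 \<Longrightarrow> norm (I n - L) < \<epsilon> / 3"
      using LIMSEQ_D[OF L e3] by auto
    define n where "n = max N1 N2"
    let ?S = "\<lambda>f \<D>. \<Sum>(x, K)\<in>\<D>. f x * (g (Sup K) - g (Inf K))"
    obtain \<delta> where \<delta>: "\<delta> > 0"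
      "\<And>\<D>. \<D> tagged_division_of {a..b} \<Longrightarrow> (\<lambda>x. ball x \<delta>) fine \<D> \<Longrightarrow> norm (?S (h n) \<D> - I n) < \<epsilon> / 3"
      using I[of n] e3 unfolding has_RS_integral_def by meson
    have "norm (?S f \<D> - L) < \<epsilon>" if \<D>: "\<D> tagged_division_of {a..b}" "(\<lambda>x. ball x \<delta>) fine \<D>" for \<D>
    proof -
      have "norm (?S f \<D> - ?S (h n) \<D>) \<le> inverse (real (Suc n)) * (V b - V a)"
        using h(2) by (intro RS_sum_diff_le[OF V ab \<D>(1)] less_imp_le) auto
      moreover have "inverse (real (Suc n)) * W < \<epsilon> / 3" "norm (I n - L) < \<epsilon> / 3"
        using N1[of n] N2[of n] by (auto simp: n_def)
      moreover have "norm (?S f \<D> - L) \<le> norm (?S f \<D> - ?S (h n) \<D>) + norm (?S (h n) \<D> - I n) + norm (I n - L)"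
        using norm_triangle_ineq[of "?S f \<D> - ?S (h n) \<D> + (?S (h n) \<D> - I n)" "I n - L"]
          norm_triangle_ineq[of "?S f \<D> - ?S (h n) \<D>" "?S (h n) \<D> - I n"] by simp
      ultimately show ?thesis
        using \<delta>(2)[OF \<D>] by (simp add: W_def)
    qed
    then show "\<exists>\<delta>>0. \<forall>\<D>. \<D> tagged_division_of {a..b} \<and> (\<lambda>x. ball x \<delta>) fine \<D> \<longrightarrow>
        norm (?S f \<D> - L) < \<epsilon>"
      using \<delta>(1) by blast
  qed
  then show ?thesis ..
qed

lemma has_RS_integral_add:
  assumes "has_RS_integral f g I a b" "has_RS_integral h g J a b"
  shows "has_RS_integral (\<lambda>x. f x + h x) g (I + J) a b"
  unfolding has_RS_integral_def
proof (intro allI impI)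
  fix \<epsilon> :: real assume "\<epsilon> > 0"
  then have e2: "\<epsilon> / 2 > 0" by simp
  let ?S = "\<lambda>f \<D>. \<Sum>(x, K)\<in>\<D>. f x * (g (Sup K) - g (Inf K))"
  obtain d1 where d1: "d1 > 0"
    "\<And>\<D>. \<D> tagged_division_of {a..b} \<Longrightarrow> (\<lambda>x. ball x d1) fine \<D> \<Longrightarrow> norm (?S f \<D> - I) < \<epsilon> / 2"
    using assms(1) e2 unfolding has_RS_integral_def by meson
  obtain d2 where d2: "d2 > 0"
    "\<And>\<D>. \<D> tagged_division_of {a..b} \<Longrightarrow> (\<lambda>x. ball x d2) fine \<D> \<Longrightarrow> norm (?S h \<D> - J) < \<epsilon> / 2"
    using assms(2) e2 unfolding has_RS_integral_def by meson
  have "norm (?S (\<lambda>x. f x + h x) \<D> - (I + J)) < \<epsilon>"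
    if \<D>: "\<D> tagged_division_of {a..b}" "(\<lambda>x. ball x (min d1 d2)) fine \<D>" for \<D>
  proof -
    have "(\<lambda>x. ball x d1) fine \<D>" "(\<lambda>x. ball x d2) fine \<D>"
      using \<D>(2) by (force simp: fine_def)+
    then have "norm (?S f \<D> - I) < \<epsilon> / 2" "norm (?S h \<D> - J) < \<epsilon> / 2"
      using d1 d2 \<D>(1) by auto
    moreover have "?S (\<lambda>x. f x + h x) \<D> - (I + J) = (?S f \<D> - I) + (?S h \<D> - J)"
      by (simp add: case_prod_unfold distrib_right sum.distrib)
    ultimately show ?thesis
      using norm_triangle_lt[of "?S f \<D> - I" "?S h \<D> - J" \<epsilon>] by (simp only:)
  qed
  then show "\<exists>\<delta>>0. \<forall>\<D>. \<D> tagged_division_of {a..b} \<and> (\<lambda>x. ball x \<delta>) fine \<D> \<longrightarrow>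
      norm (?S (\<lambda>x. f x + h x) \<D> - (I + J)) < \<epsilon>"
    using d1(1) d2(1) by (intro exI[of _ "min d1 d2"]) auto
qed

lemma has_RS_integral_mult_left:
  assumes "has_RS_integral f g I a b"
  shows "has_RS_integral (\<lambda>x. c * f x) g (c * I) a b"
  unfolding has_RS_integral_def
proof (intro allI impI)
  fix \<epsilon> :: real assume "\<epsilon> > 0"
  then have e2: "\<epsilon> / (norm c + 1) > 0" by (simp add: add_nonneg_pos)
  let ?S = "\<lambda>f \<D>. \<Sum>(x, K)\<in>\<D>. f x * (g (Sup K) - g (Inf K))"
  obtain d where d: "d > 0"
    "\<And>\<D>. \<D> tagged_division_of {a..b} \<Longrightarrow> (\<lambda>x. ball x d) fine \<D> \<Longrightarrow> norm (?S f \<D> - I) < \<epsilon> / (norm c + 1)"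
    using assms(1) e2 unfolding has_RS_integral_def by meson
  have "norm (?S (\<lambda>x. c * f x) \<D> - c * I) < \<epsilon>"
    if \<D>: "\<D> tagged_division_of {a..b}" "(\<lambda>x. ball x d) fine \<D>" for \<D>
  proof -
    have "?S (\<lambda>x. c * f x) \<D> - c * I = c * (?S f \<D> - I)"
      by (simp add: case_prod_unfold sum_distrib_left right_diff_distrib mult.assoc)
    then have "norm (?S (\<lambda>x. c * f x) \<D> - c * I) \<le> (norm c + 1) * norm (?S f \<D> - I)"
      by (simp add: norm_mult distrib_right)
    also have "\<dots> < (norm c + 1) * (\<epsilon> / (norm c + 1))"
      using d(2)[OF \<D>] by (intro mult_strict_left_mono) (auto simp: add_nonneg_pos)
    also have "\<dots> = \<epsilon>"
      using norm_ge_zero[of c] by (simp add: add_nonneg_eq_0_iff)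
    finally show ?thesis .
  qed
  then show "\<exists>\<delta>>0. \<forall>\<D>. \<D> tagged_division_of {a..b} \<and> (\<lambda>x. ball x \<delta>) fine \<D> \<longrightarrow>
      norm (?S (\<lambda>x. c * f x) \<D> - c * I) < \<epsilon>"
    using d(1) by blast
qed

text \<open>
  The points \<open>x k\<close> may coincide. The corresponding tagged intervals are then identified in the set
  \<open>\<D> n\<close>, but only degenerate intervals can be, and these contribute 0 to the sum.
\<close>

lemma tagged_division_of_partition:
  fixes x :: "nat \<Rightarrow> real" and f g :: "real \<Rightarrow> complex"
  assumes x: "\<And>k. x k \<le> x (Suc k)"
  defines "\<D> n \<equiv> (\<lambda>k. (x k, {x k..x (Suc k)})) ` {..<n}"
  shows "\<D> (Suc n) tagged_division_of {x 0..x (Suc n)}"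
    and "(\<Sum>(t, K)\<in>\<D> n. f t * (g (Sup K) - g (Inf K))) = (\<Sum>k<n. f (x k) * (g (x (Suc k)) - g (x k)))"
proof -
  have mono: "x i \<le> x j" if "i \<le> j" for i j
    using x that by (rule lift_Suc_mono_le)
  have single: "{(x k, {x k..x (Suc k)})} tagged_division_of {x k..x (Suc k)}" for k
    using tagged_division_of_self[of "x k" "x k" "x (Suc k)"] x by simp
  have D_Suc: "\<D> (Suc n) = insert (x n, {x n..x (Suc n)}) (\<D> n)" for n
    by (simp add: \<D>_def lessThan_Suc)
  have td: "\<D> (Suc n) tagged_division_of {x 0..x (Suc n)}" for n
  proof (induction n)
    case 0
    then show ?case using single[of 0] by (simp add: \<D>_def lessThan_Suc)
  next
    case (Suc n)
    have "{(x (Suc n), {x (Suc n)..x (Suc (Suc n))})} \<union> \<D> (Suc n)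
        tagged_division_of {x (Suc n)..x (Suc (Suc n))} \<union> {x 0..x (Suc n)}"
      by (intro tagged_division_Un single Suc) auto
    moreover have "{x (Suc n)..x (Suc (Suc n))} \<union> {x 0..x (Suc n)} = {x 0..x (Suc (Suc n))}"
      using mono[of 0 "Suc n"] mono[of "Suc n" "Suc (Suc n)"] by auto
    ultimately show ?case
      unfolding D_Suc[of "Suc n"] by simp
  qed
  show "\<D> (Suc n) tagged_division_of {x 0..x (Suc n)}" by (rule td)
  show "(\<Sum>(t, K)\<in>\<D> n. f t * (g (Sup K) - g (Inf K))) = (\<Sum>k<n. f (x k) * (g (x (Suc k)) - g (x k)))"
  proof (induction n)
    case (Suc n)
    show ?case
    proof (cases "(x n, {x n..x (Suc n)}) \<in> \<D> n")
      case True
      then obtain k where k: "k < n" "{x n..x (Suc n)} = {x k..x (Suc k)}"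
        by (auto simp: \<D>_def)
      have "x (Suc n) = x (Suc k)" "x n = x k"
        using k(2) x by (auto simp: Icc_eq_Icc)
      moreover have "x (Suc k) \<le> x n"
        using k by (intro mono) auto
      ultimately have "x (Suc n) = x n" using x[of n] by auto
      then show ?thesis
        using Suc True by (simp add: D_Suc insert_absorb)
    next
      case False
      moreover have "finite (\<D> n)" by (simp add: \<D>_def)
      ultimately show ?thesis
        unfolding D_Suc using Suc x[of n] by simp
    qed
  qed (simp add: \<D>_def)
qed

lemma has_RS_integral_partition_limit:
  fixes x :: "nat \<Rightarrow> nat \<Rightarrow> real"
  assumes I: "has_RS_integral f g I a b"
    and mono: "\<And>N k. x N k \<le> x N (Suc k)"
    and ends: "\<And>N. x N 0 = a" "\<And>N. x N (Suc (n N)) = b"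
    and mesh: "\<And>N k. x N (Suc k) - x N k \<le> d N" and d: "d \<longlonglongrightarrow> 0"
  shows "(\<lambda>N. \<Sum>k<Suc (n N). f (x N k) * (g (x N (Suc k)) - g (x N k))) \<longlonglongrightarrow> I"
proof (rule LIMSEQ_I)
  fix \<epsilon> :: real assume "\<epsilon> > 0"
  let ?S = "\<lambda>\<D>. \<Sum>(x, K)\<in>\<D>. f x * (g (Sup K) - g (Inf K))"
  obtain \<delta> where \<delta>: "\<delta> > 0"
    "\<And>\<D>. \<D> tagged_division_of {a..b} \<Longrightarrow> (\<lambda>x. ball x \<delta>) fine \<D> \<Longrightarrow> norm (?S \<D> - I) < \<epsilon>"
    using I \<open>\<epsilon> > 0\<close> unfolding has_RS_integral_def by meson
  obtain N0 where N0: "\<And>N. N \<ge> N0 \<Longrightarrow> d N < \<delta>"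
    using order_tendstoD(2)[OF d \<delta>(1)] by (auto simp: eventually_sequentially)
  have "norm ((\<Sum>k<Suc (n N). f (x N k) * (g (x N (Suc k)) - g (x N k))) - I) < \<epsilon>" if "N \<ge> N0" for N
  proof -
    let ?D = "(\<lambda>k. (x N k, {x N k..x N (Suc k)})) ` {..<Suc (n N)}"
    have "?D tagged_division_of {a..b}"
      using tagged_division_of_partition(1)[of "x N" "n N"] mono ends by simp
    moreover have "(\<lambda>x. ball x \<delta>) fine ?D"
    proof -
      have "{x N k..x N (Suc k)} \<subseteq> ball (x N k) \<delta>" for k
        using mesh[of N k] N0[OF that] by (auto simp: dist_real_def)
      then show ?thesis by (auto simp: fine_def)
    qed
    ultimately have "norm (?S ?D - I) < \<epsilon>" by (rule \<delta>(2))
    then show ?thesis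
      using tagged_division_of_partition(2)[of "x N" f g "Suc (n N)"] mono by simp
  qed
  then show "\<exists>N0. \<forall>N\<ge>N0. norm ((\<Sum>k<Suc (n N). f (x N k) * (g (x N (Suc k)) - g (x N k))) - I) < \<epsilon>"
    by blast
qed

section \<open>Hoelder's inequality\<close>

text \<open>
  Young's inequality for \<open>f / a\<close> and \<open>g / b\<close>, where \<open>a\<close> and \<open>b\<close> are the two norms, integrates to
  \<open>\<integral> f g \<le> a b (1 / p + 1 / q)\<close>. If one of the norms vanishes, then so does \<open>f g\<close> almost
  everywhere.
\<close>

lemma Holder_inequality:
  fixes f g :: "'a \<Rightarrow> real"
  assumes pq: "1 < p" "1 < q" "1 / p + 1 / q = 1"
    and [measurable]: "f \<in> borel_measurable M" "g \<in> borel_measurable M"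
    and nn: "\<And>x. 0 \<le> f x" "\<And>x. 0 \<le> g x"
    and f: "integrable M (\<lambda>x. f x powr p)" and g: "integrable M (\<lambda>x. g x powr q)"
  shows "integrable M (\<lambda>x. f x * g x)"
    and "(\<integral>x. f x * g x \<partial>M) \<le> (\<integral>x. f x powr p \<partial>M) powr (1 / p) * (\<integral>x. g x powr q \<partial>M) powr (1 / q)"
proof -
  have "integrable M (\<lambda>x. f x powr p / p + g x powr q / q)"
    using f g by simp
  then show fg: "integrable M (\<lambda>x. f x * g x)"
    by (rule Bochner_Integration.integrable_bound) (use Youngs_inequality[OF pq] nn in \<open>auto intro!: AE_I2 simp: abs_mult intro: order_trans[OF _ abs_ge_self]\<close>)
  define A B where "A = (\<integral>x. f x powr p \<partial>M)" and "B = (\<integral>x. g x powr q \<partial>M)"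
  have AB: "A \<ge> 0" "B \<ge> 0" by (simp_all add: A_def B_def)
  have zero: "(\<integral>x. f x * g x \<partial>M) = 0" if "A = 0 \<or> B = 0"
  proof -
    have "AE x in M. f x * g x = 0"
      using that
    proof
      assume "A = 0"
      then have "AE x in M. f x powr p = 0"
        using integral_nonneg_eq_0_iff_AE[OF f] by (simp add: A_def)
      then show ?thesis by eventually_elim simp
    next
      assume "B = 0"
      then have "AE x in M. g x powr q = 0"
        using integral_nonneg_eq_0_iff_AE[OF g] by (simp add: B_def)
      then show ?thesis by eventually_elim simp
    qed
    then show ?thesis by (rule integral_eq_zero_AE)
  qed
  show "(\<integral>x. f x * g x \<partial>M) \<le> A powr (1 / p) * B powr (1 / q)"
  proof (cases "A = 0 \<or> B = 0")
    case True
    then show ?thesis using zero by auto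
  next
    case False
    then have pos: "A > 0" "B > 0" using AB by auto
    define a b where "a = A powr (1 / p)" and "b = B powr (1 / q)"
    have ab: "a > 0" "b > 0" "a powr p = A" "b powr q = B"
      using pos pq by (simp_all add: a_def b_def powr_powr)
    have "(\<integral>x. f x * g x \<partial>M) / (a * b) = (\<integral>x. (f x / a) * (g x / b) \<partial>M)"
      by simp
    also have "\<dots> \<le> (\<integral>x. f x powr p / (A * p) + g x powr q / (B * q) \<partial>M)"
    proof (rule integral_mono)
      show "integrable M (\<lambda>x. f x / a * (g x / b))"
        using fg by simp
      show "integrable M (\<lambda>x. f x powr p / (A * p) + g x powr q / (B * q))"
        using f g by simp
      fix x
      have "(f x / a) * (g x / b) \<le> (f x / a) powr p / p + (g x / b) powr q / q"
        using nn ab by (intro Youngs_inequality pq) auto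
      then show "f x / a * (g x / b) \<le> f x powr p / (A * p) + g x powr q / (B * q)"
        using ab nn by (simp add: powr_divide)
    qed
    also have "\<dots> = A / (A * p) + B / (B * q)"
      using f g by (simp add: A_def B_def)
    also have "\<dots> = 1"
      using pos pq by simp
    finally show ?thesis
      using ab by (simp add: a_def b_def divide_le_eq)
  qed
qed

section \<open>The convolution estimate\<close>

lemma integrable_lebesgue_on_Icc_bounded:
  fixes f :: "real \<Rightarrow> 'b::{banach, second_countable_topology}"
  assumes "f \<in> borel_measurable (lebesgue_on {a..b})" "\<And>x. x \<in> {a..b} \<Longrightarrow> norm (f x) \<le> c"
  shows "integrable (lebesgue_on {a..b}) f"
proof -
  interpret finite_measure "lebesgue_on {a..b}"
    by (rule finite_measure_lebesgue_on) simp
  show ?thesis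
    using assms by (intro integrable_const_bound[of _ c]) (auto intro!: AE_I2)
qed

text \<open>
  The integrand is the translate by \<open>\<theta>\<close> of \<open>u\<close> extended by 0 to the left; translation moves the
  part of it that lies in \<open>[-r, 0]\<close> to \<open>[0, -\<theta>]\<close>, a subinterval of \<open>[0, r]\<close>.
\<close>

lemma lebesgue_integral_shift_le:
  fixes u :: "real \<Rightarrow> real"
  assumes u: "continuous_on {0..r} u" and nn: "\<And>x. x \<in> {0..r} \<Longrightarrow> u x \<ge> 0"
    and \<theta>: "-r \<le> \<theta>" "\<theta> \<le> 0"
  shows "integrable (lebesgue_on {-r..0}) (\<lambda>\<xi>. if \<theta> \<le> \<xi> then u (\<xi> - \<theta>) else 0)"
    and "(\<integral>\<xi>. (if \<theta> \<le> \<xi> then u (\<xi> - \<theta>) else 0) \<partial>lebesgue_on {-r..0}) \<le> (\<integral>x. u x \<partial>lebesgue_on {0..r})"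
proof -
  let ?v = "\<lambda>\<xi>. if \<theta> \<le> \<xi> then u (\<xi> - \<theta>) else 0"
  have "bounded (u ` {0..r})"
    using u by (intro compact_imp_bounded compact_continuous_image) auto
  then obtain c where c: "c > 0" "\<And>x. x \<in> {0..r} \<Longrightarrow> norm (u x) \<le> c"
    by (auto simp: bounded_pos)
  have u': "u integrable_on {0..r}"
    using u by (rule integrable_continuous_real)
  then have "u integrable_on {0..-\<theta>}"
    by (rule integrable_on_subinterval) (use \<theta> in auto)
  then have "(u has_integral integral {0..-\<theta>} u) {0..-\<theta>}"
    by (rule integrable_integral)
  then have "((\<lambda>\<xi>. u (\<xi> - \<theta>)) has_integral integral {0..-\<theta>} u) {\<theta>..0}"
    using has_integral_shift_real_ivl[of u _ 0 "-\<theta>" "-\<theta>"] by simp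
  then have "((\<lambda>\<xi>. if \<xi> \<in> {\<theta>..0} then u (\<xi> - \<theta>) else 0) has_integral integral {0..-\<theta>} u) {-r..0}"
    using \<theta> by (subst has_integral_restrict) auto
  then have v: "(?v has_integral integral {0..-\<theta>} u) {-r..0}"
    by (rule has_integral_eq[rotated]) auto
  have int_v: "integrable (lebesgue_on {-r..0}) ?v"
  proof (rule integrable_lebesgue_on_Icc_bounded)
    have "?v absolutely_integrable_on {-r..0}"
      using v nn \<theta> by (intro nonnegative_absolutely_integrable_1) (auto simp: has_integral_iff)
    then show "?v \<in> borel_measurable (lebesgue_on {-r..0})"
      by (simp add: absolutely_integrable_measurable)
    show "norm (?v \<xi>) \<le> c" if "\<xi> \<in> {-r..0}" for \<xi>
      using c that \<theta> by auto
  qed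
  then show "integrable (lebesgue_on {-r..0}) ?v" .
  have "(\<integral>\<xi>. ?v \<xi> \<partial>lebesgue_on {-r..0}) = integral {0..-\<theta>} u"
    using int_v v by (simp add: lebesgue_integral_eq_integral has_integral_iff)
  also have "\<dots> \<le> integral {0..r} u"
    using \<open>u integrable_on {0..-\<theta>}\<close> u' nn \<theta> by (intro integral_subset_le) auto
  also have "\<dots> = (\<integral>x. u x \<partial>lebesgue_on {0..r})"
    using u by (simp add: lebesgue_integral_eq_integral continuous_imp_integrable_real)
  finally show "(\<integral>\<xi>. ?v \<xi> \<partial>lebesgue_on {-r..0}) \<le> (\<integral>x. u x \<partial>lebesgue_on {0..r})" .
qed

lemma has_RS_integral_convolution:
  assumes V: "variation_bound V g (-r) 0" and \<psi>: "continuous_on {0..r} \<psi>" and \<xi>: "\<xi> \<in> {-r..0}"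
  shows "has_RS_integral (\<lambda>\<theta>. \<psi> (\<xi> - \<theta>)) g (RS_integral (-r) \<xi> (\<lambda>\<theta>. \<psi> (\<xi> - \<theta>)) g) (-r) \<xi>"
proof -
  have V\<xi>: "variation_bound V g (-r) \<xi>"
    using variation_bound_subinterval[OF V] \<xi> by simp
  have "continuous_on {-r..\<xi>} (\<lambda>\<theta>. \<psi> (\<xi> - \<theta>))"
    by (rule continuous_on_compose2[OF \<psi>]) (use \<xi> in \<open>auto intro!: continuous_intros\<close>)
  then obtain I where "has_RS_integral (\<lambda>\<theta>. \<psi> (\<xi> - \<theta>)) g I (-r) \<xi>"
    using has_RS_integral_continuous[OF V\<xi>] \<xi> by auto
  then show ?thesis by (simp add: RS_integral_eq)
qed

text \<open>
  This is the analytic core. Formally, by Fubini's theorem the integral is at most the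
  integral against \<open>|dg|(\<theta>)\<close> of the integral over \<open>[\<theta>, 0]\<close> of
  \<open>|\<psi> (\<xi> - \<theta>)| |\<phi> \<xi>|\<close> in \<open>\<xi>\<close>,
  and by Hoelder's inequality the inner integral is at most the product of the two norms for
  each \<open>\<theta>\<close>. To avoid integration against \<open>|dg|\<close>, the inner Stieltjes integral \<open>F \<xi>\<close> is replaced
  by its Riemann--Stieltjes sums \<open>S N \<xi>\<close>. These are taken over one partition
  \<open>\<theta> N 0 \<le> \<theta> N 1 \<le> \<dots>\<close> of the whole of \<open>[-r, 0]\<close>, cut off at \<open>\<xi>\<close>: their points are
  \<open>x N k \<xi> = min (\<theta> N k) \<xi>\<close>. Because the partition does not depend on \<open>\<xi>\<close>, the
  bound \<open>|S N \<xi>| \<le> (\<Sum>k. D N k * A N k \<xi>)\<close>, with \<open>A N k\<close> the modulus of \<open>\<psi>\<close> translated by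
  \<open>\<theta> N k\<close> and \<open>D N k = V (\<theta> N (Suc k)) - V (\<theta> N k)\<close>, has weights
  independent of \<open>\<xi>\<close>, so that Hoelder's inequality applies to each summand and the weights
  add up to \<open>V 0 - V (-r)\<close>. Dominated convergence carries the bound over to \<open>F\<close>, which is
  measurable as a pointwise limit of the measurable functions \<open>S N\<close>.
\<close>

lemma RS_convolution_bound:
  fixes g \<psi> \<phi> :: "real \<Rightarrow> complex"
  assumes r: "r > 0" and V: "variation_bound V g (-r) 0"
    and \<psi>: "continuous_on {0..r} \<psi>" and \<phi>: "continuous_on {-r..0} \<phi>"
    and pq: "1 < p" "1 < q" "1 / p + 1 / q = 1"
  defines "F \<equiv> \<lambda>\<xi>. RS_integral (-r) \<xi> (\<lambda>\<theta>. \<psi> (\<xi> - \<theta>)) g"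
  shows "(\<lambda>\<xi>. F \<xi> * \<phi> \<xi>) integrable_on {-r..0}"
    and "norm (integral {-r..0} (\<lambda>\<xi>. F \<xi> * \<phi> \<xi>)) \<le> (V 0 - V (-r)) *
      ((\<integral>x. norm (\<psi> x) powr q \<partial>lebesgue_on {0..r}) powr (1 / q) *
       (\<integral>x. norm (\<phi> x) powr p \<partial>lebesgue_on {-r..0}) powr (1 / p))"
proof -
  let ?L = "lebesgue_on {-r..0}"
  \<comment> \<open>Only the values of \<open>g\<close> on \<open>[-r, 0]\<close> are controlled; clamping gives a Borel function on the line.\<close>
  define gc where "gc x = g (max (-r) (min 0 x))" for x
  have gc_meas[measurable]: "gc \<in> borel_measurable borel"
    unfolding gc_def using variation_bound_borel_measurable[OF V] r by simp
  have gc: "gc x = g x" if "x \<in> {-r..0}" for x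
    using that by (auto simp: gc_def max_def min_def)
  define \<theta> where "\<theta> N k = -r + real k * (r / real (Suc N))" for N k :: nat
  have \<theta>_ge: "-r \<le> \<theta> N k" for N k using r by (simp add: \<theta>_def)
  have \<theta>_mono: "\<theta> N k \<le> \<theta> N (Suc k)" for N k
    unfolding \<theta>_def using r by (intro add_left_mono mult_right_mono) auto
  have \<theta>_diff: "\<theta> N (Suc k) - \<theta> N k = r / real (Suc N)" for N k
    unfolding \<theta>_def of_nat_Suc[of k] distrib_right by simp
  have \<theta>_end: "\<theta> N (Suc N) = 0" for N by (simp add: \<theta>_def del: of_nat_Suc)
  have \<theta>_le: "\<theta> N k \<le> 0" if "k \<le> Suc N" for N k
    using lift_Suc_mono_le[of "\<theta> N", OF \<theta>_mono that] \<theta>_end by simp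
  define x where "x N k \<xi> = min (\<theta> N k) \<xi>" for N k \<xi>
  define S where "S N \<xi> = (\<Sum>k<Suc N. \<psi> (\<xi> - x N k \<xi>) * (gc (x N (Suc k) \<xi>) - gc (x N k \<xi>)))" for N \<xi>
  define A where "A N k \<xi> = (if \<theta> N k \<le> \<xi> then norm (\<psi> (\<xi> - \<theta> N k)) else 0)" for N k \<xi>
  define D where "D N k = V (\<theta> N (Suc k)) - V (\<theta> N k)" for N k
  have D_nn: "D N k \<ge> 0" if "k < Suc N" for N k
    using variation_bound_mono[OF V \<theta>_ge \<theta>_mono \<theta>_le, of k] that by (simp add: D_def)
  have D_sum: "(\<Sum>k<Suc N. D N k) = V 0 - V (-r)" for N
    unfolding D_def by (subst sum_lessThan_telescope) (simp add: \<theta>_end, simp add: \<theta>_def)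
  have xI: "x N k \<xi> \<in> {-r..0}" "\<xi> - x N k \<xi> \<in> {0..r}" if "\<xi> \<in> {-r..0}" for N k \<xi>
    using \<theta>_ge[of N k] that by (auto simp: x_def min_def)
  have lim: "(\<lambda>N. S N \<xi>) \<longlonglongrightarrow> F \<xi>" if \<xi>: "\<xi> \<in> {-r..0}" for \<xi>
  proof -
    have "(\<lambda>N. \<Sum>k<Suc N. \<psi> (\<xi> - x N k \<xi>) * (g (x N (Suc k) \<xi>) - g (x N k \<xi>))) \<longlonglongrightarrow> F \<xi>"
      unfolding F_def
    proof (rule has_RS_integral_partition_limit[OF has_RS_integral_convolution[OF V \<psi> \<xi>], where d = "\<lambda>N. r / real (Suc N)"])
      show "x N k \<xi> \<le> x N (Suc k) \<xi>" for N k
        using \<theta>_mono[of N k] by (auto simp: x_def min_def)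
      show "x N 0 \<xi> = -r" "x N (Suc N) \<xi> = \<xi>" for N
        using \<xi> r \<theta>_end[of N] by (auto simp: x_def \<theta>_def)
      show "x N (Suc k) \<xi> - x N k \<xi> \<le> r / real (Suc N)" for N k
        using \<theta>_diff[of N k] \<theta>_mono[of N k] by (auto simp: x_def min_def)
      show "(\<lambda>N. r / real (Suc N)) \<longlonglongrightarrow> 0"
        using LIMSEQ_Suc[OF lim_const_over_n[of r]] by simp
    qed
    then show ?thesis
      using xI[OF \<xi>] by (simp add: S_def gc)
  qed
  have S_le: "norm (S N \<xi>) \<le> (\<Sum>k<Suc N. D N k * A N k \<xi>)" if \<xi>: "\<xi> \<in> {-r..0}" for N \<xi>
    unfolding S_def
  proof (rule sum_norm_le)
    fix k assume "k \<in> {..<Suc N}"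
    then have k: "k < Suc N" by simp
    show "norm (\<psi> (\<xi> - x N k \<xi>) * (gc (x N (Suc k) \<xi>) - gc (x N k \<xi>))) \<le> D N k * A N k \<xi>"
    proof (cases "\<theta> N k \<le> \<xi>")
      case True
      then have xk: "x N k \<xi> = \<theta> N k" by (simp add: x_def)
      have xs: "\<theta> N k \<le> x N (Suc k) \<xi>" "x N (Suc k) \<xi> \<le> \<theta> N (Suc k)"
        using True \<theta>_mono[of N k] by (auto simp: x_def)
      have "norm (gc (x N (Suc k) \<xi>) - gc (x N k \<xi>)) = norm (g (x N (Suc k) \<xi>) - g (\<theta> N k))"
        using xI(1)[OF \<xi>] by (simp add: gc flip: xk)
      also have "\<dots> \<le> V (x N (Suc k) \<xi>) - V (\<theta> N k)"
        using xs \<theta>_ge xI(1)[OF \<xi>] by (intro variation_boundD[OF V]) auto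
      also have "\<dots> \<le> D N k"
        using variation_bound_mono[OF V _ xs(2)] xI(1)[OF \<xi>, of N "Suc k"] \<theta>_le[of "Suc k" N] k
        by (simp add: D_def)
      finally have "norm (gc (x N (Suc k) \<xi>) - gc (x N k \<xi>)) \<le> D N k" .
      then have "norm (\<psi> (\<xi> - \<theta> N k)) * norm (gc (x N (Suc k) \<xi>) - gc (x N k \<xi>)) \<le> norm (\<psi> (\<xi> - \<theta> N k)) * D N k"
        by (rule mult_left_mono) simp
      then show ?thesis
        using True by (simp add: A_def norm_mult xk mult.commute)
    next
      case False
      then have "x N (Suc k) \<xi> = x N k \<xi>" using \<theta>_mono[of N k] by (auto simp: x_def)
      then show ?thesis using D_nn[OF k] False by (simp add: A_def)
    qed
  qed
  have "bounded (\<psi> ` {0..r})"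
    using \<psi> by (intro compact_imp_bounded compact_continuous_image) auto
  then obtain c where c: "c > 0" "\<And>x. x \<in> {0..r} \<Longrightarrow> norm (\<psi> x) \<le> c"
    by (auto simp: bounded_pos)
  have "bounded (\<phi> ` {-r..0})"
    using \<phi> by (intro compact_imp_bounded compact_continuous_image) auto
  then obtain d where d: "d > 0" "\<And>x. x \<in> {-r..0} \<Longrightarrow> norm (\<phi> x) \<le> d"
    by (auto simp: bounded_pos)
  have A_le: "A N k \<xi> \<le> c" if "\<xi> \<in> {-r..0}" for N k \<xi>
    using c \<theta>_ge[of N k] that by (auto simp: A_def)
  have A_nn: "A N k \<xi> \<ge> 0" for N k \<xi> by (simp add: A_def)
  have S_c: "norm (S N \<xi>) \<le> (V 0 - V (-r)) * c" if \<xi>: "\<xi> \<in> {-r..0}" for N \<xi>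
  proof -
    have "(\<Sum>k<Suc N. D N k * A N k \<xi>) \<le> (\<Sum>k<Suc N. D N k * c)"
      using D_nn A_le[OF \<xi>] by (intro sum_mono mult_left_mono) auto
    also have "\<dots> = (V 0 - V (-r)) * c"
      by (simp only: D_sum flip: sum_distrib_right)
    finally show ?thesis using S_le[OF \<xi>, of N] by linarith
  qed
  have \<phi>_meas[measurable]: "\<phi> \<in> borel_measurable ?L"
    using \<phi> by (intro continuous_imp_measurable_on_sets_lebesgue) auto
  have S_meas[measurable]: "S N \<in> borel_measurable ?L" for N
    unfolding S_def
  proof (intro borel_measurable_sum borel_measurable_times borel_measurable_diff)
    fix k
    have "continuous_on {-r..0} (\<lambda>\<xi>. \<psi> (\<xi> - x N k \<xi>))"
      using xI(2) by (intro continuous_on_compose2[OF \<psi>]) (auto simp: x_def intro!: continuous_intros)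
    then show "(\<lambda>\<xi>. \<psi> (\<xi> - x N k \<xi>)) \<in> borel_measurable ?L"
      by (intro continuous_imp_measurable_on_sets_lebesgue) auto
    have gx: "(\<lambda>\<xi>. gc (x N k \<xi>)) \<in> borel_measurable ?L" for k
    proof -
      have "(\<lambda>\<xi>. gc (x N k \<xi>)) \<in> borel_measurable lborel"
        unfolding x_def by measurable
      then show ?thesis
        by (intro measurable_restrict_space1 measurable_completion)
    qed
    show "(\<lambda>\<xi>. gc (x N (Suc k) \<xi>)) \<in> borel_measurable ?L" "(\<lambda>\<xi>. gc (x N k \<xi>)) \<in> borel_measurable ?L"
      by (rule gx)+
  qed
  have F_meas: "F \<in> borel_measurable ?L"
    by (rule borel_measurable_LIMSEQ_metric[where f = S]) (use lim in auto)
  have dom: "AE \<xi> in ?L. norm (S N \<xi> * \<phi> \<xi>) \<le> (V 0 - V (-r)) * c * d" for N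
  proof (rule AE_I2)
    fix \<xi> assume "\<xi> \<in> space ?L"
    then have \<xi>: "\<xi> \<in> {-r..0}" by simp
    show "norm (S N \<xi> * \<phi> \<xi>) \<le> (V 0 - V (-r)) * c * d"
      unfolding norm_mult
      using S_c[OF \<xi>, of N] d(2)[OF \<xi>] order_trans[OF norm_ge_zero S_c[OF \<xi>, of N]] by (intro mult_mono) auto
  qed
  have limAE: "AE \<xi> in ?L. (\<lambda>N. S N \<xi> * \<phi> \<xi>) \<longlonglongrightarrow> F \<xi> * \<phi> \<xi>"
    by (rule AE_I2) (auto intro!: tendsto_mult lim)
  have int_F: "integrable ?L (\<lambda>\<xi>. F \<xi> * \<phi> \<xi>)"
    by (rule integrable_dominated_convergence[where w = "\<lambda>_. (V 0 - V (-r)) * c * d", OF _ _ _ limAE dom])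
      (use F_meas in auto)
  then show int_F': "(\<lambda>\<xi>. F \<xi> * \<phi> \<xi>) integrable_on {-r..0}"
    by (rule integrable_on_lebesgue_on) simp
  have int_lim: "(\<lambda>N. \<integral>\<xi>. S N \<xi> * \<phi> \<xi> \<partial>?L) \<longlonglongrightarrow> (\<integral>\<xi>. F \<xi> * \<phi> \<xi> \<partial>?L)"
    by (rule integral_dominated_convergence[where w = "\<lambda>_. (V 0 - V (-r)) * c * d", OF _ _ _ limAE dom])
      (use F_meas in auto)
  define P Q where "P = (\<integral>x. norm (\<phi> x) powr p \<partial>?L) powr (1 / p)"
    and "Q = (\<integral>x. norm (\<psi> x) powr q \<partial>lebesgue_on {0..r}) powr (1 / q)"
  have each: "integrable ?L (\<lambda>\<xi>. A N k \<xi> * norm (\<phi> \<xi>))"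
    "(\<integral>\<xi>. A N k \<xi> * norm (\<phi> \<xi>) \<partial>?L) \<le> Q * P" if k: "k < Suc N" for N k
  proof -
    have t: "-r \<le> \<theta> N k" "\<theta> N k \<le> 0" using \<theta>_ge \<theta>_le k by auto
    have "continuous_on {0..r} (\<lambda>x. norm (\<psi> x))"
      using \<psi> by (intro continuous_intros)
    from lebesgue_integral_shift_le(1)[OF this _ t]
    have A_meas: "A N k \<in> borel_measurable ?L"
      unfolding A_def by (intro borel_measurable_integrable) simp
    have "continuous_on {0..r} (\<lambda>x. norm (\<psi> x) powr q)"
      using \<psi> pq by (intro continuous_on_powr' continuous_intros) auto
    note shift = lebesgue_integral_shift_le[OF this _ t]
    have Aq: "A N k \<xi> powr q = (if \<theta> N k \<le> \<xi> then norm (\<psi> (\<xi> - \<theta> N k)) powr q else 0)" for \<xi>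
      by (simp add: A_def)
    have intA: "integrable ?L (\<lambda>\<xi>. A N k \<xi> powr q)"
      "(\<integral>\<xi>. A N k \<xi> powr q \<partial>?L) \<le> (\<integral>x. norm (\<psi> x) powr q \<partial>lebesgue_on {0..r})"
      unfolding Aq using shift by auto
    have int\<phi>: "integrable ?L (\<lambda>\<xi>. norm (\<phi> \<xi>) powr p)"
      using \<phi> pq by (intro continuous_imp_integrable_real continuous_on_powr' continuous_intros) auto
    have qp: "1 / q + 1 / p = 1" using pq by simp
    note H = Holder_inequality[OF pq(2,1) qp A_meas _ _ _ intA(1) int\<phi>]
    show "integrable ?L (\<lambda>\<xi>. A N k \<xi> * norm (\<phi> \<xi>))"
      using A_nn by (intro H(1)) auto
    have "(\<integral>\<xi>. A N k \<xi> * norm (\<phi> \<xi>) \<partial>?L) \<le> (\<integral>\<xi>. A N k \<xi> powr q \<partial>?L) powr (1 / q) * P"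
      unfolding P_def using A_nn by (intro H(2)) auto
    also have "\<dots> \<le> Q * P"
      unfolding Q_def using intA(2) pq by (intro mult_right_mono powr_mono2) (auto simp: P_def)
    finally show "(\<integral>\<xi>. A N k \<xi> * norm (\<phi> \<xi>) \<partial>?L) \<le> Q * P" .
  qed
  have S_bound: "norm (\<integral>\<xi>. S N \<xi> * \<phi> \<xi> \<partial>?L) \<le> (V 0 - V (-r)) * (Q * P)" for N
  proof -
    have "norm (\<integral>\<xi>. S N \<xi> * \<phi> \<xi> \<partial>?L) \<le> (\<integral>\<xi>. (\<Sum>k<Suc N. D N k * (A N k \<xi> * norm (\<phi> \<xi>))) \<partial>?L)"
    proof (rule Bochner_Integration.integral_norm_bound_integral)
      show "integrable ?L (\<lambda>\<xi>. S N \<xi> * \<phi> \<xi>)"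
        by (rule integrable_dominated_convergence2[where w = "\<lambda>_. (V 0 - V (-r)) * c * d", OF _ _ _ limAE dom])
          (use F_meas in auto)
      show "integrable ?L (\<lambda>\<xi>. \<Sum>k<Suc N. D N k * (A N k \<xi> * norm (\<phi> \<xi>)))"
        using each(1) by (intro Bochner_Integration.integrable_sum integrable_mult_right) auto
      fix \<xi> assume "\<xi> \<in> space ?L"
      then have "\<xi> \<in> {-r..0}" by simp
      from S_le[OF this, of N]
      have "norm (S N \<xi>) * norm (\<phi> \<xi>) \<le> (\<Sum>k<Suc N. D N k * A N k \<xi>) * norm (\<phi> \<xi>)"
        by (rule mult_right_mono) simp
      then show "norm (S N \<xi> * \<phi> \<xi>) \<le> (\<Sum>k<Suc N. D N k * (A N k \<xi> * norm (\<phi> \<xi>)))"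
        by (simp only: norm_mult sum_distrib_right mult.assoc)
    qed
    also have "\<dots> = (\<Sum>k<Suc N. D N k * (\<integral>\<xi>. A N k \<xi> * norm (\<phi> \<xi>) \<partial>?L))"
      using each(1) by (subst Bochner_Integration.integral_sum) auto
    also have "\<dots> \<le> (\<Sum>k<Suc N. D N k * (Q * P))"
      using each(2) D_nn by (intro sum_mono mult_left_mono) auto
    also have "\<dots> = (V 0 - V (-r)) * (Q * P)"
      by (simp only: D_sum flip: sum_distrib_right)
    finally show ?thesis .
  qed
  have "norm (\<integral>\<xi>. F \<xi> * \<phi> \<xi> \<partial>?L) \<le> (V 0 - V (-r)) * (Q * P)"
    by (rule LIMSEQ_le_const2[OF tendsto_norm[OF int_lim]]) (use S_bound in auto)
  then show "norm (integral {-r..0} (\<lambda>\<xi>. F \<xi> * \<phi> \<xi>)) \<le> (V 0 - V (-r)) * (Q * P)"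
    using int_F by (simp add: lebesgue_integral_eq_integral)
qed

section \<open>Extending bounded bilinear forms from dense subspaces\<close>

definition Lp_norm :: "real \<Rightarrow> 'a measure \<Rightarrow> ('a \<Rightarrow> complex^'n) \<Rightarrow> real" where
  "Lp_norm p M f = (\<integral>x. norm (f x) powr p \<partial>M) powr (1 / p)"

lemma Lp_norm_nonneg [simp]: "Lp_norm p M f \<ge> 0"
  by (simp add: Lp_norm_def)

lemma Lp_norm_zero [simp]: "Lp_norm p M (\<lambda>x. 0) = 0"
  by (simp add: Lp_norm_def)

lemma Lp_norm_cong_AE:
  assumes "f \<in> borel_measurable M" "g \<in> borel_measurable M" "AE x in M. f x = g x"
  shows "Lp_norm p M f = Lp_norm p M g"
proof -
  have "(\<integral>x. norm (f x) powr p \<partial>M) = (\<integral>x. norm (g x) powr p \<partial>M)"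
    using assms by (intro integral_cong_AE) (auto elim: AE_mp)
  then show ?thesis by (simp add: Lp_norm_def)
qed

lemma Lp_norm_scale:
  assumes "p > 0"
  shows "Lp_norm p M (\<lambda>x. c *s f x) = norm c * Lp_norm p M f"
  using assms
  by (simp add: Lp_norm_def norm_vector_scalar_mult_complex powr_mult powr_powr)

text \<open>
  A weak form of Minkowski's inequality, which follows pointwise from
  \<open>norm (f x + g x) \<le> 2 * max (norm (f x)) (norm (g x))\<close>. For extension by density a constant factor
  is harmless, as it only enlarges the bound of the extended form.
\<close>

lemma Lp_norm_quasi_triangle:
  assumes p: "p \<ge> 1" and f: "f \<in> Lp_fun p M" and g: "g \<in> Lp_fun p M"
  shows "Lp_norm p M (\<lambda>x. f x + g x) \<le> 4 * (Lp_norm p M f + Lp_norm p M g)"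
proof -
  define A B where "A = (\<integral>x. norm (f x) powr p \<partial>M)" and "B = (\<integral>x. norm (g x) powr p \<partial>M)"
  have AB: "A \<ge> 0" "B \<ge> 0" by (simp_all add: A_def B_def)
  have intf: "integrable M (\<lambda>x. norm (f x) powr p)" and intg: "integrable M (\<lambda>x. norm (g x) powr p)"
    using f g by (auto simp: Lp_fun_def)
  have max_powr: "max a b powr s \<le> a powr s + b powr s" for a b s :: real
    by (simp add: max_def)
  have "(\<integral>x. norm (f x + g x) powr p \<partial>M) \<le> (\<integral>x. 2 powr p * (norm (f x) powr p + norm (g x) powr p) \<partial>M)"
  proof (rule integral_mono)
    show "integrable M (\<lambda>x. norm (f x + g x) powr p)"
      using Lp_fun_add[OF _ f g] p by (simp add: Lp_fun_def)
    show "integrable M (\<lambda>x. 2 powr p * (norm (f x) powr p + norm (g x) powr p))"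
      using intf intg by simp
    fix x
    have "norm (f x + g x) powr p \<le> (2 * max (norm (f x)) (norm (g x))) powr p"
      using norm_triangle_ineq[of "f x" "g x"] by (intro powr_mono2) (use p in auto)
    also have "\<dots> = 2 powr p * max (norm (f x)) (norm (g x)) powr p"
      by (simp add: powr_mult)
    also have "\<dots> \<le> 2 powr p * (norm (f x) powr p + norm (g x) powr p)"
      using max_powr by (intro mult_left_mono) auto
    finally show "norm (f x + g x) powr p \<le> 2 powr p * (norm (f x) powr p + norm (g x) powr p)" .
  qed
  also have "\<dots> = 2 powr p * (A + B)"
    using intf intg by (simp add: A_def B_def)
  also have "\<dots> \<le> 2 powr p * (2 powr p * max A B)"
  proof -
    have "2 powr 1 \<le> (2::real) powr p" using p by (intro powr_mono) auto
    then have "2 * max A B \<le> 2 powr p * max A B"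
      using AB by (intro mult_right_mono) auto
    then show ?thesis by (intro mult_left_mono) auto
  qed
  finally have "(\<integral>x. norm (f x + g x) powr p \<partial>M) \<le> 4 powr p * max A B"
    using powr_mult[of 2 2 p] by simp
  then have "Lp_norm p M (\<lambda>x. f x + g x) \<le> (4 powr p * max A B) powr (1 / p)"
    unfolding Lp_norm_def using p by (intro powr_mono2) auto
  also have "\<dots> = 4 * max A B powr (1 / p)"
    using p AB by (simp add: powr_mult powr_powr)
  also have "\<dots> \<le> 4 * (A powr (1 / p) + B powr (1 / p))"
    by (intro mult_left_mono max_powr) auto
  finally show ?thesis by (simp add: Lp_norm_def A_def B_def)
qed

lemma Lp_fun_diff:
  assumes "p \<ge> 0" "f \<in> Lp_fun p M" "g \<in> Lp_fun p M"
  shows "(\<lambda>x. f x - g x) \<in> Lp_fun p M"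
proof -
  have "(\<lambda>x. f x + (-1) *s g x) \<in> Lp_fun p M"
    using assms by (intro Lp_fun_add Lp_fun_scale)
  moreover have "(\<lambda>x. f x + (-1) *s g x) = (\<lambda>x. f x - g x)"
    by (simp add: fun_eq_iff vec_eq_iff)
  ultimately show ?thesis by (simp only:)
qed

lemma Lp_norm_minus_commute: "Lp_norm p M (\<lambda>x. f x - g x) = Lp_norm p M (\<lambda>x. g x - f x)"
  by (simp add: Lp_norm_def norm_minus_commute)

lemma Lp_norm_le_diff:
  assumes "p \<ge> 1" "f \<in> Lp_fun p M" "g \<in> Lp_fun p M"
  shows "Lp_norm p M f \<le> 4 * (Lp_norm p M (\<lambda>x. f x - g x) + Lp_norm p M g)"
  using Lp_norm_quasi_triangle[OF assms(1) Lp_fun_diff[OF _ assms(2,3)] assms(3)] assms(1) by simp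

lemma Lp_norm_diff_le:
  assumes "p \<ge> 1" "f \<in> Lp_fun p M" "g \<in> Lp_fun p M" "h \<in> Lp_fun p M"
  shows "Lp_norm p M (\<lambda>x. f x - g x) \<le> 4 * (Lp_norm p M (\<lambda>x. f x - h x) + Lp_norm p M (\<lambda>x. g x - h x))"
  using Lp_norm_quasi_triangle[OF assms(1) Lp_fun_diff[OF _ assms(2,4)] Lp_fun_diff[OF _ assms(4,3)]] assms(1)
  by (simp add: Lp_norm_minus_commute[of p M h g])

definition Lp_subspace :: "real \<Rightarrow> 'a measure \<Rightarrow> ('a \<Rightarrow> complex^'n) set \<Rightarrow> bool" where
  "Lp_subspace p M S \<longleftrightarrow> S \<subseteq> Lp_fun p M \<and>
     (\<forall>f\<in>S. \<forall>g\<in>S. (\<lambda>x. f x + g x) \<in> S) \<and> (\<forall>c. \<forall>f\<in>S. (\<lambda>x. c *s f x) \<in> S)"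

lemma Lp_subspaceD:
  assumes "Lp_subspace p M S"
  shows "f \<in> S \<Longrightarrow> f \<in> Lp_fun p M"
    and "f \<in> S \<Longrightarrow> g \<in> S \<Longrightarrow> (\<lambda>x. f x + g x) \<in> S"
    and "f \<in> S \<Longrightarrow> (\<lambda>x. c *s f x) \<in> S"
  using assms by (auto simp: Lp_subspace_def)

lemma Lp_subspace_Lp_fun: "p \<ge> 0 \<Longrightarrow> Lp_subspace p M (Lp_fun p M)"
  by (auto simp: Lp_subspace_def intro: Lp_fun_add Lp_fun_scale)

lemma Lp_subspace_diff:
  assumes "Lp_subspace p M S" "f \<in> S" "g \<in> S"
  shows "(\<lambda>x. f x - g x) \<in> S"
proof -
  have "(\<lambda>x. f x + (-1) *s g x) \<in> S"
    using assms by (intro Lp_subspaceD[OF assms(1)])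
  moreover have "(\<lambda>x. f x + (-1) *s g x) = (\<lambda>x. f x - g x)"
    by (simp add: fun_eq_iff vec_eq_iff)
  ultimately show ?thesis by (simp only:)
qed

definition Lp_converges ::
    "real \<Rightarrow> 'a measure \<Rightarrow> ('i \<Rightarrow> 'a \<Rightarrow> complex^'n) \<Rightarrow> ('a \<Rightarrow> complex^'n) \<Rightarrow> 'i filter \<Rightarrow> bool" where
  "Lp_converges p M u f F \<longleftrightarrow> ((\<lambda>i. Lp_norm p M (\<lambda>x. u i x - f x)) \<longlongrightarrow> 0) F"

definition Lp_dense :: "real \<Rightarrow> 'a measure \<Rightarrow> ('a \<Rightarrow> complex^'n) set \<Rightarrow> bool" where
  "Lp_dense p M S \<longleftrightarrow>
     (\<forall>f\<in>Lp_fun p M. \<exists>u. (\<forall>k. u k \<in> S) \<and> Lp_converges p M u f sequentially)"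

lemma Lp_converges_const: "Lp_converges p M (\<lambda>_. f) f F"
  by (simp add: Lp_converges_def)

lemma Lp_converges_cong_AE:
  assumes "\<And>i. u i \<in> borel_measurable M" "f \<in> borel_measurable M" "g \<in> borel_measurable M"
    and "AE x in M. f x = g x" and "Lp_converges p M u f F"
  shows "Lp_converges p M u g F"
proof -
  have "Lp_norm p M (\<lambda>x. u i x - f x) = Lp_norm p M (\<lambda>x. u i x - g x)" for i
    using assms by (intro Lp_norm_cong_AE) (auto elim: AE_mp)
  then show ?thesis using assms(5) by (simp add: Lp_converges_def)
qed

lemma Lp_converges_add:
  assumes p: "p \<ge> 1" and Lp: "\<And>i. u i \<in> Lp_fun p M" "\<And>i. v i \<in> Lp_fun p M" "f \<in> Lp_fun p M" "g \<in> Lp_fun p M"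
    and u: "Lp_converges p M u f F" and v: "Lp_converges p M v g F"
  shows "Lp_converges p M (\<lambda>i x. u i x + v i x) (\<lambda>x. f x + g x) F"
  unfolding Lp_converges_def
proof (rule tendsto_sandwich[OF _ _ tendsto_const])
  show "((\<lambda>i. 4 * (Lp_norm p M (\<lambda>x. u i x - f x) + Lp_norm p M (\<lambda>x. v i x - g x))) \<longlongrightarrow> 0) F"
    using tendsto_mult_left[OF tendsto_add[OF u[unfolded Lp_converges_def] v[unfolded Lp_converges_def]], of 4] by simp
  have "Lp_norm p M (\<lambda>x. (u i x - f x) + (v i x - g x))
      \<le> 4 * (Lp_norm p M (\<lambda>x. u i x - f x) + Lp_norm p M (\<lambda>x. v i x - g x))" for i
    using p Lp by (intro Lp_norm_quasi_triangle Lp_fun_diff) auto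
  then show "\<forall>\<^sub>F i in F. Lp_norm p M (\<lambda>x. u i x + v i x - (f x + g x))
      \<le> 4 * (Lp_norm p M (\<lambda>x. u i x - f x) + Lp_norm p M (\<lambda>x. v i x - g x))"
    by (simp add: algebra_simps)
qed auto

lemma Lp_converges_scale:
  assumes "p > 0" "Lp_converges p M u f F"
  shows "Lp_converges p M (\<lambda>i x. c *s u i x) (\<lambda>x. c *s f x) F"
proof -
  have "Lp_norm p M (\<lambda>x. c *s u i x - c *s f x) = norm c * Lp_norm p M (\<lambda>x. u i x - f x)" for i
    using Lp_norm_scale[OF assms(1), of M c "\<lambda>x. u i x - f x"] by (simp only: vector_ssub_ldistrib)
  then show ?thesis
    using tendsto_mult_left[OF assms(2)[unfolded Lp_converges_def], of "norm c"]
    by (simp add: Lp_converges_def)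
qed

text \<open>
  Bilinear forms are considered on functions instead of equivalence classes, so that the form on
  continuous functions, its extension, and a form on \<open>L\<^sup>q \<times> L\<^sup>p\<close> composed with the quotient maps
  are all instances. Boundedness makes such a form respect equality almost everywhere.
\<close>

locale bounded_bilinear_on =
  fixes q p :: real and M :: "'a measure" and N :: "'b measure"
    and S :: "('a \<Rightarrow> complex^'n) set" and T :: "('b \<Rightarrow> complex^'m) set"
    and \<beta> :: "('a \<Rightarrow> complex^'n) \<Rightarrow> ('b \<Rightarrow> complex^'m) \<Rightarrow> complex"
    and K :: real
  assumes q: "q \<ge> 1" and p: "p \<ge> 1"
    and S: "Lp_subspace q M S" and T: "Lp_subspace p N T"
    and add_left: "\<And>f f' g. f \<in> S \<Longrightarrow> f' \<in> S \<Longrightarrow> g \<in> T \<Longrightarrow> \<beta> (\<lambda>x. f x + f' x) g = \<beta> f g + \<beta> f' g"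
    and scale_left: "\<And>c f g. f \<in> S \<Longrightarrow> g \<in> T \<Longrightarrow> \<beta> (\<lambda>x. c *s f x) g = c * \<beta> f g"
    and add_right: "\<And>f g g'. f \<in> S \<Longrightarrow> g \<in> T \<Longrightarrow> g' \<in> T \<Longrightarrow> \<beta> f (\<lambda>x. g x + g' x) = \<beta> f g + \<beta> f g'"
    and scale_right: "\<And>c f g. f \<in> S \<Longrightarrow> g \<in> T \<Longrightarrow> \<beta> f (\<lambda>x. c *s g x) = c * \<beta> f g"
    and bound: "\<And>f g. f \<in> S \<Longrightarrow> g \<in> T \<Longrightarrow> norm (\<beta> f g) \<le> K * Lp_norm q M f * Lp_norm p N g"
    and K: "K \<ge> 0"
begin

lemma S_Lp: "f \<in> S \<Longrightarrow> f \<in> Lp_fun q M" and T_Lp: "g \<in> T \<Longrightarrow> g \<in> Lp_fun p N"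
  using S T by (auto simp: Lp_subspace_def)

lemma diff_left:
  assumes "f \<in> S" "f' \<in> S" "g \<in> T"
  shows "\<beta> (\<lambda>x. f x - f' x) g = \<beta> f g - \<beta> f' g"
  using add_left[OF Lp_subspace_diff[OF S assms(1,2)] assms(2,3)] by simp

lemma diff_right:
  assumes "f \<in> S" "g \<in> T" "g' \<in> T"
  shows "\<beta> f (\<lambda>x. g x - g' x) = \<beta> f g - \<beta> f g'"
  using add_right[OF assms(1) Lp_subspace_diff[OF T assms(2,3)] assms(3)] by simp

text \<open>
  The usual splitting \<open>\<beta> f g - \<beta> f' g' = \<beta> (f - f') g + \<beta> f' (g - g')\<close>.
\<close>

lemma diff_bound:
  assumes "f \<in> S" "f' \<in> S" "g \<in> T" "g' \<in> T"
  shows "norm (\<beta> f g - \<beta> f' g') \<le>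
    K * Lp_norm q M (\<lambda>x. f x - f' x) * Lp_norm p N g + K * Lp_norm q M f' * Lp_norm p N (\<lambda>x. g x - g' x)"
proof -
  have "\<beta> f g - \<beta> f' g' = \<beta> (\<lambda>x. f x - f' x) g + \<beta> f' (\<lambda>x. g x - g' x)"
    using assms by (simp add: diff_left diff_right)
  also have "norm \<dots> \<le> norm (\<beta> (\<lambda>x. f x - f' x) g) + norm (\<beta> f' (\<lambda>x. g x - g' x))"
    by (rule norm_triangle_ineq)
  also have "\<dots> \<le> K * Lp_norm q M (\<lambda>x. f x - f' x) * Lp_norm p N g + K * Lp_norm q M f' * Lp_norm p N (\<lambda>x. g x - g' x)"
    using assms S T by (intro add_mono bound Lp_subspace_diff) auto
  finally show ?thesis .
qed

text \<open>
  A general filter serves three purposes. The product filter on pairs of indices gives the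
  Cauchy property of \<open>\<beta> (u k) (v k)\<close>; two sequences with the same limits give independence of the
  approximation; and a constant second sequence gives continuity of \<open>\<beta>\<close>, where the limits
  belong to the subspaces.
\<close>

lemma same_limit:
  assumes mem: "\<And>i. u i \<in> S" "\<And>i. u' i \<in> S" "\<And>i. v i \<in> T" "\<And>i. v' i \<in> T"
    and f: "f \<in> Lp_fun q M" and g: "g \<in> Lp_fun p N"
    and lim: "Lp_converges q M u f F" "Lp_converges q M u' f F" "Lp_converges p N v g F" "Lp_converges p N v' g F"
  shows "((\<lambda>i. \<beta> (u i) (v i) - \<beta> (u' i) (v' i)) \<longlongrightarrow> 0) F"
proof -
  define a where "a = (\<lambda>i. Lp_norm q M (\<lambda>x. u i x - f x))"
  define a' where "a' = (\<lambda>i. Lp_norm q M (\<lambda>x. u' i x - f x))"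
  define b where "b = (\<lambda>i. Lp_norm p N (\<lambda>x. v i x - g x))"
  define b' where "b' = (\<lambda>i. Lp_norm p N (\<lambda>x. v' i x - g x))"
  define A where "A = Lp_norm q M f"
  define B where "B = Lp_norm p N g"
  have lims: "(a \<longlongrightarrow> 0) F" "(a' \<longlongrightarrow> 0) F" "(b \<longlongrightarrow> 0) F" "(b' \<longlongrightarrow> 0) F"
    using lim by (simp_all add: Lp_converges_def a_def a'_def b_def b'_def)
  let ?R = "\<lambda>i. K * (4 * (a i + a' i)) * (4 * (b i + B)) + K * (4 * (a' i + A)) * (4 * (b i + b' i))"
  have "(?R \<longlongrightarrow> K * (4 * (0 + 0)) * (4 * (0 + B)) + K * (4 * (0 + A)) * (4 * (0 + 0))) F"
    by (intro tendsto_intros lims)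
  then have R: "(?R \<longlongrightarrow> 0) F" by simp
  have le: "norm (\<beta> (u i) (v i) - \<beta> (u' i) (v' i)) \<le> ?R i" for i
  proof -
    have "Lp_norm q M (\<lambda>x. u i x - u' i x) \<le> 4 * (a i + a' i)"
      unfolding a_def a'_def using q mem f S_Lp by (intro Lp_norm_diff_le) auto
    moreover have "Lp_norm p N (\<lambda>x. v i x - v' i x) \<le> 4 * (b i + b' i)"
      unfolding b_def b'_def using p mem g T_Lp by (intro Lp_norm_diff_le) auto
    moreover have "Lp_norm p N (v i) \<le> 4 * (b i + B)"
      unfolding b_def B_def using p mem g T_Lp by (intro Lp_norm_le_diff) auto
    moreover have "Lp_norm q M (u' i) \<le> 4 * (a' i + A)"
      unfolding a'_def A_def using q mem f S_Lp by (intro Lp_norm_le_diff) auto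
    moreover have "a i \<ge> 0" "a' i \<ge> 0" "b i \<ge> 0" "b' i \<ge> 0" "A \<ge> 0" "B \<ge> 0"
      by (simp_all add: a_def a'_def b_def b'_def A_def B_def)
    ultimately have "K * Lp_norm q M (\<lambda>x. u i x - u' i x) * Lp_norm p N (v i)
        + K * Lp_norm q M (u' i) * Lp_norm p N (\<lambda>x. v i x - v' i x) \<le> ?R i"
      using K by (intro add_mono mult_mono) auto
    then show ?thesis
      using diff_bound[OF mem(1,2,3,4), of i i i i] by (rule order_trans[rotated])
  qed
  show ?thesis
    by (rule Lim_null_comparison[OF always_eventually R]) (rule allI, rule le)
qed

end

locale dense_bounded_bilinear = bounded_bilinear_on q p M N S T \<beta> K
  for q p :: real and M :: "'a measure" and N :: "'b measure"
    and S :: "('a \<Rightarrow> complex^'n) set" and T :: "('b \<Rightarrow> complex^'m) set" and \<beta> K +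
  assumes dense_S: "Lp_dense q M S" and dense_T: "Lp_dense p N T"
begin

lemma convergent_along:
  assumes mem: "\<And>k. u k \<in> S" "\<And>k. v k \<in> T"
    and f: "f \<in> Lp_fun q M" and g: "g \<in> Lp_fun p N"
    and lim: "Lp_converges q M u f sequentially" "Lp_converges p N v g sequentially"
  shows "convergent (\<lambda>k. \<beta> (u k) (v k))"
proof -
  let ?F = "sequentially \<times>\<^sub>F sequentially :: (nat \<times> nat) filter"
  have "((\<lambda>i. \<beta> (u (fst i)) (v (fst i)) - \<beta> (u (snd i)) (v (snd i))) \<longlongrightarrow> 0) ?F"
  proof (rule same_limit[OF _ _ _ _ f g])
    show "Lp_converges q M (\<lambda>i. u (fst i)) f ?F" "Lp_converges q M (\<lambda>i. u (snd i)) f ?F"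
      "Lp_converges p N (\<lambda>i. v (fst i)) g ?F" "Lp_converges p N (\<lambda>i. v (snd i)) g ?F"
      using lim filterlim_fst[of sequentially sequentially] filterlim_snd[of sequentially sequentially]
      unfolding Lp_converges_def by (auto intro: filterlim_compose)
  qed (use mem in auto)
  then have "\<forall>\<^sub>F i in ?F. dist (\<beta> (u (fst i)) (v (fst i)) - \<beta> (u (snd i)) (v (snd i))) 0 < e" if "e > 0" for e
    using that by (rule tendstoD)
  then have "Cauchy (\<lambda>k. \<beta> (u k) (v k))"
    unfolding Cauchy_iff eventually_prod_sequentially by (auto simp: dist_norm) (metis norm_minus_commute)
  then show ?thesis by (rule Cauchy_convergent)
qed

definition extension :: "('a \<Rightarrow> complex^'n) \<Rightarrow> ('b \<Rightarrow> complex^'m) \<Rightarrow> complex" where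
  "extension f g = lim (\<lambda>k. \<beta> ((SOME u. (\<forall>k. u k \<in> S) \<and> Lp_converges q M u f sequentially) k)
                       ((SOME v. (\<forall>k. v k \<in> T) \<and> Lp_converges p N v g sequentially) k))"

lemma extension_limit:
  assumes mem: "\<And>k. u k \<in> S" "\<And>k. v k \<in> T"
    and f: "f \<in> Lp_fun q M" and g: "g \<in> Lp_fun p N"
    and lim: "Lp_converges q M u f sequentially" "Lp_converges p N v g sequentially"
  shows "(\<lambda>k. \<beta> (u k) (v k)) \<longlonglongrightarrow> extension f g"
proof -
  define u0 where "u0 = (SOME u. (\<forall>k. u k \<in> S) \<and> Lp_converges q M u f sequentially)"
  define v0 where "v0 = (SOME v. (\<forall>k. v k \<in> T) \<and> Lp_converges p N v g sequentially)"
  have "\<exists>u. (\<forall>k. u k \<in> S) \<and> Lp_converges q M u f sequentially"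
    using dense_S f by (auto simp: Lp_dense_def)
  then have u0: "(\<forall>k. u0 k \<in> S) \<and> Lp_converges q M u0 f sequentially"
    unfolding u0_def by (rule someI_ex)
  have "\<exists>v. (\<forall>k. v k \<in> T) \<and> Lp_converges p N v g sequentially"
    using dense_T g by (auto simp: Lp_dense_def)
  then have v0: "(\<forall>k. v0 k \<in> T) \<and> Lp_converges p N v0 g sequentially"
    unfolding v0_def by (rule someI_ex)
  have "(\<lambda>k. \<beta> (u0 k) (v0 k)) \<longlonglongrightarrow> extension f g"
    using convergent_along[of u0 v0 f g] u0 v0 f g
    unfolding extension_def u0_def[symmetric] v0_def[symmetric] by (simp add: convergent_LIMSEQ_iff)
  moreover have "(\<lambda>k. \<beta> (u k) (v k) - \<beta> (u0 k) (v0 k)) \<longlonglongrightarrow> 0"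
    using u0 v0 mem lim f g by (intro same_limit) auto
  ultimately show ?thesis
    using tendsto_add by fastforce
qed

lemma approx_left:
  "f \<in> Lp_fun q M \<Longrightarrow> \<exists>u. (\<forall>k. u k \<in> S) \<and> Lp_converges q M u f sequentially"
  using dense_S by (simp add: Lp_dense_def)

lemma approx_right:
  "g \<in> Lp_fun p N \<Longrightarrow> \<exists>v. (\<forall>k. v k \<in> T) \<and> Lp_converges p N v g sequentially"
  using dense_T by (simp add: Lp_dense_def)

lemma extension_eq: "f \<in> S \<Longrightarrow> g \<in> T \<Longrightarrow> extension f g = \<beta> f g"
  using extension_limit[of "\<lambda>_. f" "\<lambda>_. g" f g] S_Lp T_Lp
  by (simp add: Lp_converges_const LIMSEQ_const_iff)

lemma extension_cong_AE:
  assumes f: "f \<in> Lp_fun q M" "f' \<in> Lp_fun q M" "AE x in M. f x = f' x"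
    and g: "g \<in> Lp_fun p N" "g' \<in> Lp_fun p N" "AE x in N. g x = g' x"
  shows "extension f g = extension f' g'"
proof -
  obtain u where u: "\<And>k. u k \<in> S" "Lp_converges q M u f sequentially"
    using approx_left[OF f(1)] by blast
  obtain v where v: "\<And>k. v k \<in> T" "Lp_converges p N v g sequentially"
    using approx_right[OF g(1)] by blast
  have "Lp_converges q M u f' sequentially"
    by (rule Lp_converges_cong_AE[OF _ _ _ f(3) u(2)]) (use u(1) S_Lp f in \<open>auto simp: Lp_fun_def\<close>)
  moreover have "Lp_converges p N v g' sequentially"
    by (rule Lp_converges_cong_AE[OF _ _ _ g(3) v(2)]) (use v(1) T_Lp g in \<open>auto simp: Lp_fun_def\<close>)
  ultimately have "(\<lambda>k. \<beta> (u k) (v k)) \<longlonglongrightarrow> extension f' g'"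
    using u v f g by (intro extension_limit) auto
  moreover have "(\<lambda>k. \<beta> (u k) (v k)) \<longlonglongrightarrow> extension f g"
    using u v f g by (intro extension_limit) auto
  ultimately show ?thesis by (rule LIMSEQ_unique[symmetric])
qed

text \<open>
  All properties pass to the limit along approximating sequences, because sums and multiples of
  approximating sequences approximate sums and multiples. The factor \<open>16 = 4 \<cdot> 4\<close> comes from
  estimating the norms of the approximating functions by the norms of \<open>f\<close> and \<open>g\<close> with the weak
  triangle inequality.
\<close>

lemma bounded_bilinear_on_extension:
  "bounded_bilinear_on q p M N (Lp_fun q M) (Lp_fun p N) extension (16 * K)"
proof
  show "1 \<le> q" "1 \<le> p" by (rule q p)+
  show "Lp_subspace q M (Lp_fun q M)" "Lp_subspace p N (Lp_fun p N)"
    using q p by (auto intro: Lp_subspace_Lp_fun)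
  show "0 \<le> 16 * K" using K by simp
next
  fix f f' :: "'a \<Rightarrow> complex^'n" and g :: "'b \<Rightarrow> complex^'m"
  assume f: "f \<in> Lp_fun q M" "f' \<in> Lp_fun q M" and g: "g \<in> Lp_fun p N"
  obtain u where u: "\<And>k. u k \<in> S" "Lp_converges q M u f sequentially"
    using approx_left[OF f(1)] by blast
  obtain u' where u': "\<And>k. u' k \<in> S" "Lp_converges q M u' f' sequentially"
    using approx_left[OF f(2)] by blast
  obtain v where v: "\<And>k. v k \<in> T" "Lp_converges p N v g sequentially"
    using approx_right[OF g] by blast
  have "(\<lambda>k. \<beta> (\<lambda>x. u k x + u' k x) (v k)) \<longlonglongrightarrow> extension (\<lambda>x. f x + f' x) g"
  proof (rule extension_limit)
    show "(\<lambda>x. u k x + u' k x) \<in> S" for k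
      using S u(1) u'(1) by (simp add: Lp_subspace_def)
    show "Lp_converges q M (\<lambda>k x. u k x + u' k x) (\<lambda>x. f x + f' x) sequentially"
      using q u u' f S_Lp by (intro Lp_converges_add) auto
    show "(\<lambda>x. f x + f' x) \<in> Lp_fun q M"
      using q f by (intro Lp_fun_add) auto
  qed (use v g in auto)
  moreover have "(\<lambda>k. \<beta> (u k) (v k) + \<beta> (u' k) (v k)) \<longlonglongrightarrow> extension f g + extension f' g"
    using u u' v f g by (intro tendsto_add extension_limit) auto
  ultimately show "extension (\<lambda>x. f x + f' x) g = extension f g + extension f' g"
    using u(1) u'(1) v(1) by (simp add: add_left) (rule LIMSEQ_unique)
next
  fix c and f :: "'a \<Rightarrow> complex^'n" and g :: "'b \<Rightarrow> complex^'m"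
  assume f: "f \<in> Lp_fun q M" and g: "g \<in> Lp_fun p N"
  obtain u where u: "\<And>k. u k \<in> S" "Lp_converges q M u f sequentially"
    using approx_left[OF f] by blast
  obtain v where v: "\<And>k. v k \<in> T" "Lp_converges p N v g sequentially"
    using approx_right[OF g] by blast
  have lim: "(\<lambda>k. \<beta> (u k) (v k)) \<longlonglongrightarrow> extension f g"
    using u v f g by (intro extension_limit) auto
  have lim': "(\<lambda>k. c * \<beta> (u k) (v k)) \<longlonglongrightarrow> c * extension f g"
    by (rule tendsto_mult_left[OF lim])
  have "(\<lambda>k. \<beta> (\<lambda>x. c *s u k x) (v k)) \<longlonglongrightarrow> extension (\<lambda>x. c *s f x) g"
    using S u v f g q by (intro extension_limit Lp_converges_scale Lp_fun_scale) (auto simp: Lp_subspace_def)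
  then show "extension (\<lambda>x. c *s f x) g = c * extension f g"
    using lim' u(1) v(1) by (simp add: scale_left) (rule LIMSEQ_unique)
  have "(\<lambda>k. \<beta> (u k) (\<lambda>x. c *s v k x)) \<longlonglongrightarrow> extension f (\<lambda>x. c *s g x)"
    using T u v f g p by (intro extension_limit Lp_converges_scale Lp_fun_scale) (auto simp: Lp_subspace_def)
  then show "extension f (\<lambda>x. c *s g x) = c * extension f g"
    using lim' u(1) v(1) by (simp add: scale_right) (rule LIMSEQ_unique)
  show "norm (extension f g) \<le> 16 * K * Lp_norm q M f * Lp_norm p N g"
  proof (rule tendsto_le[OF _ _ tendsto_norm[OF lim]])
    let ?R = "\<lambda>k. K * (4 * (Lp_norm q M (\<lambda>x. u k x - f x) + Lp_norm q M f)) * (4 * (Lp_norm p N (\<lambda>x. v k x - g x) + Lp_norm p N g))"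
    have "?R \<longlonglongrightarrow> K * (4 * (0 + Lp_norm q M f)) * (4 * (0 + Lp_norm p N g))"
      using u(2) v(2) unfolding Lp_converges_def by (intro tendsto_intros)
    then show "?R \<longlonglongrightarrow> 16 * K * Lp_norm q M f * Lp_norm p N g"
      by (simp add: mult_ac)
    have "norm (\<beta> (u k) (v k)) \<le> ?R k" for k
    proof -
      have "norm (\<beta> (u k) (v k)) \<le> K * Lp_norm q M (u k) * Lp_norm p N (v k)"
        using u v by (intro bound)
      also have "\<dots> \<le> ?R k"
        using K q p u(1) v(1) f g S_Lp T_Lp by (intro mult_mono Lp_norm_le_diff) auto
      finally show ?thesis .
    qed
    then show "\<forall>\<^sub>F k in sequentially. norm (\<beta> (u k) (v k)) \<le> ?R k" by simp
  qed simp
next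
  fix f :: "'a \<Rightarrow> complex^'n" and g g' :: "'b \<Rightarrow> complex^'m"
  assume f: "f \<in> Lp_fun q M" and g: "g \<in> Lp_fun p N" "g' \<in> Lp_fun p N"
  obtain u where u: "\<And>k. u k \<in> S" "Lp_converges q M u f sequentially"
    using approx_left[OF f] by blast
  obtain v where v: "\<And>k. v k \<in> T" "Lp_converges p N v g sequentially"
    using approx_right[OF g(1)] by blast
  obtain v' where v': "\<And>k. v' k \<in> T" "Lp_converges p N v' g' sequentially"
    using approx_right[OF g(2)] by blast
  have "(\<lambda>k. \<beta> (u k) (\<lambda>x. v k x + v' k x)) \<longlonglongrightarrow> extension f (\<lambda>x. g x + g' x)"
  proof (rule extension_limit)
    show "(\<lambda>x. v k x + v' k x) \<in> T" for k
      using T v(1) v'(1) by (simp add: Lp_subspace_def)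
    show "Lp_converges p N (\<lambda>k x. v k x + v' k x) (\<lambda>x. g x + g' x) sequentially"
      using p v v' g T_Lp by (intro Lp_converges_add) auto
    show "(\<lambda>x. g x + g' x) \<in> Lp_fun p N"
      using p g by (intro Lp_fun_add) auto
  qed (use u f in auto)
  moreover have "(\<lambda>k. \<beta> (u k) (v k) + \<beta> (u k) (v' k)) \<longlonglongrightarrow> extension f g + extension f g'"
    using u v v' f g by (intro tendsto_add extension_limit) auto
  ultimately show "extension f (\<lambda>x. g x + g' x) = extension f g + extension f g'"
    using u(1) v'(1) v(1) by (simp add: add_right) (rule LIMSEQ_unique)
qed

end

lemma Lp_nrm_class': "f \<in> Lp_fun p M \<Longrightarrow> nrm (Lp p M) (Lp_class p M f) = Lp_norm p M f"
  by (simp add: Lp_nrm_class Lp_norm_def)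

lemma Lp_class_points: "f \<in> Lp_fun p M \<Longrightarrow> Lp_class p M f \<in> points (Lp p M)"
  by (simp add: Lp_points)

lemma bounded_bilinear_on_of_form:
  fixes M :: "'a measure" and N :: "'b measure"
    and b :: "('a \<Rightarrow> complex^'n) set \<times> ('b \<Rightarrow> complex^'m) set \<Rightarrow> complex"
  assumes "q \<ge> 1" "p \<ge> 1" and bil: "bilinear_form (Lp q M) (Lp p N) b" and bdd: "bounded_form (Lp q M) (Lp p N) b"
  shows "\<exists>K. bounded_bilinear_on q p M N (Lp_fun q M) (Lp_fun p N) (\<lambda>f g. b (Lp_class q M f, Lp_class p N g)) K"
proof -
  obtain K where K: "K > 0"
    "\<And>x y. x \<in> points (Lp q M) \<Longrightarrow> y \<in> points (Lp p N) \<Longrightarrow> norm (b (x, y)) \<le> K * nrm (Lp q M) x * nrm (Lp p N) y"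
    using bdd by (auto simp: bounded_form_def)
  have "bounded_bilinear_on q p M N (Lp_fun q M) (Lp_fun p N) (\<lambda>f g. b (Lp_class q M f, Lp_class p N g)) K"
  proof
    show "Lp_subspace q M (Lp_fun q M)" "Lp_subspace p N (Lp_fun p N)"
      using assms by (auto intro: Lp_subspace_Lp_fun)
  next
    fix f f' :: "'a \<Rightarrow> complex^'n" and g :: "'b \<Rightarrow> complex^'m"
    assume "f \<in> Lp_fun q M" "f' \<in> Lp_fun q M" "g \<in> Lp_fun p N"
    then show "b (Lp_class q M (\<lambda>x. f x + f' x), Lp_class p N g) = b (Lp_class q M f, Lp_class p N g) + b (Lp_class q M f', Lp_class p N g)"
      using bil assms(1) by (simp add: bilinear_form_def Lp_class_points flip: Lp_add_class)
  next
    fix f :: "'a \<Rightarrow> complex^'n" and g g' :: "'b \<Rightarrow> complex^'m"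
    assume "f \<in> Lp_fun q M" "g \<in> Lp_fun p N" "g' \<in> Lp_fun p N"
    then show "b (Lp_class q M f, Lp_class p N (\<lambda>x. g x + g' x)) = b (Lp_class q M f, Lp_class p N g) + b (Lp_class q M f, Lp_class p N g')"
      using bil assms(2) by (simp add: bilinear_form_def Lp_class_points flip: Lp_add_class)
  next
    fix c and f :: "'a \<Rightarrow> complex^'n" and g :: "'b \<Rightarrow> complex^'m"
    assume fg: "f \<in> Lp_fun q M" "g \<in> Lp_fun p N"
    then show "b (Lp_class q M (\<lambda>x. c *s f x), Lp_class p N g) = c * b (Lp_class q M f, Lp_class p N g)"
      "b (Lp_class q M f, Lp_class p N (\<lambda>x. c *s g x)) = c * b (Lp_class q M f, Lp_class p N g)"
      using bil by (simp_all add: bilinear_form_def Lp_class_points flip: Lp_scale_class)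
    show "norm (b (Lp_class q M f, Lp_class p N g)) \<le> K * Lp_norm q M f * Lp_norm p N g"
      using K(2)[OF Lp_class_points Lp_class_points] fg by (simp add: Lp_nrm_class')
  qed (use assms K in auto)
  then show ?thesis ..
qed

text \<open>
  Passing to equivalence classes: the extension depends only on classes, and conversely a bounded
  bilinear form on classes is, as a form on functions, continuous and hence determined by its
  values on the dense subspaces.
\<close>

theorem (in dense_bounded_bilinear) unique_extension:
  "\<exists>!b. b \<in> (points (Lp q M) \<times> points (Lp p N)) \<rightarrow>\<^sub>E (UNIV :: complex set)
       \<and> bilinear_form (Lp q M) (Lp p N) b
       \<and> bounded_form (Lp q M) (Lp p N) b
       \<and> (\<forall>f\<in>S. \<forall>g\<in>T. b (Lp_class q M f, Lp_class p N g) = \<beta> f g)" (is "\<exists>!b. ?P b")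
proof (rule ex1I)
  interpret E: bounded_bilinear_on q p M N "Lp_fun q M" "Lp_fun p N" extension "16 * K"
    by (rule bounded_bilinear_on_extension)
  let ?X = "points (Lp q M :: ('a \<Rightarrow> complex^'n) set normed_structure)
    \<times> points (Lp p N :: ('b \<Rightarrow> complex^'m) set normed_structure)"
  define b where "b = restrict (\<lambda>(X, Y). extension (rep X) (rep Y)) ?X"
  have b: "b (Lp_class q M f, Lp_class p N g) = extension f g" if "f \<in> Lp_fun q M" "g \<in> Lp_fun p N"
    for f :: "'a \<Rightarrow> complex^'n" and g :: "'b \<Rightarrow> complex^'m"
  proof -
    have "b (Lp_class q M f, Lp_class p N g) = extension (rep (Lp_class q M f)) (rep (Lp_class p N g))"
      using that by (simp add: b_def Lp_points)
    also have "\<dots> = extension f g"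
      using that by (intro extension_cong_AE rep_Lp_class)
    finally show ?thesis .
  qed
  show "?P b"
  proof (intro conjI)
    show "b \<in> ?X \<rightarrow>\<^sub>E UNIV" by (auto simp: b_def)
    show "bilinear_form (Lp q M) (Lp p N) b"
      using q p unfolding bilinear_form_def Lp_points
      by (auto simp: Lp_add_class Lp_scale_class b Lp_fun_add Lp_fun_scale E.add_left E.add_right E.scale_left E.scale_right)
    \<comment> \<open>A bounded form needs a strictly positive constant, while \<open>K\<close> may be 0.\<close>
    have "norm (b (X, Y)) \<le> (16 * K + 1) * nrm (Lp q M) X * nrm (Lp p N) Y"
      if XY: "X \<in> points (Lp q M)" "Y \<in> points (Lp p N)" for X Y
    proof -
      obtain f g where fg: "f \<in> Lp_fun q M" "X = Lp_class q M f" "g \<in> Lp_fun p N" "Y = Lp_class p N g"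
        using XY by (auto simp: Lp_points)
      have "norm (extension f g) \<le> 16 * K * (Lp_norm q M f * Lp_norm p N g)"
        using E.bound[OF fg(1,3)] by (simp add: mult.assoc)
      also have "\<dots> \<le> (16 * K + 1) * (Lp_norm q M f * Lp_norm p N g)"
        by (intro mult_right_mono) auto
      finally show ?thesis using fg by (simp add: b Lp_nrm_class' mult.assoc)
    qed
    moreover have "16 * K + 1 > 0" using K by simp
    ultimately show "bounded_form (Lp q M) (Lp p N) b"
      unfolding bounded_form_def by blast
    show "\<forall>f\<in>S. \<forall>g\<in>T. b (Lp_class q M f, Lp_class p N g) = \<beta> f g"
      using S_Lp T_Lp by (auto simp: b extension_eq)
  qed
  fix b' assume b': "?P b'"
  show "b' = b"
  proof (rule PiE_ext)
    show "b' \<in> ?X \<rightarrow>\<^sub>E UNIV" using b' by blast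
    show "b \<in> ?X \<rightarrow>\<^sub>E UNIV" by (auto simp: b_def)
    fix z assume "z \<in> ?X"
    then obtain f :: "'a \<Rightarrow> complex^'n" and g :: "'b \<Rightarrow> complex^'m" where z: "f \<in> Lp_fun q M" "g \<in> Lp_fun p N" "z = (Lp_class q M f, Lp_class p N g)"
      by (auto simp: Lp_points)
    obtain K' where "bounded_bilinear_on q p M N (Lp_fun q M) (Lp_fun p N) (\<lambda>f g. b' (Lp_class q M f, Lp_class p N g)) K'"
      using bounded_bilinear_on_of_form[of q p M N b'] b' q p by auto
    then interpret B: bounded_bilinear_on q p M N "Lp_fun q M" "Lp_fun p N" "\<lambda>f g. b' (Lp_class q M f, Lp_class p N g)" K' .
    obtain u where u: "\<And>k. u k \<in> S" "Lp_converges q M u f sequentially"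
      using approx_left[OF z(1)] by blast
    obtain v where v: "\<And>k. v k \<in> T" "Lp_converges p N v g sequentially"
      using approx_right[OF z(2)] by blast
    have "(\<lambda>k. b' (Lp_class q M (u k), Lp_class p N (v k)) - b' (Lp_class q M f, Lp_class p N g)) \<longlonglongrightarrow> 0"
      using u v z S_Lp T_Lp by (intro B.same_limit[where f = f and g = g]) (auto intro: Lp_converges_const)
    then have "(\<lambda>k. \<beta> (u k) (v k) - b' z) \<longlonglongrightarrow> 0"
      using b' u(1) v(1) z(3) by simp
    then have "(\<lambda>k. \<beta> (u k) (v k)) \<longlonglongrightarrow> b' z"
      by (rule LIM_zero_cancel)
    moreover have "(\<lambda>k. \<beta> (u k) (v k)) \<longlonglongrightarrow> extension f g"
      using u v z by (intro extension_limit) auto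
    ultimately have "b' z = extension f g" by (rule LIMSEQ_unique)
    then show "b' z = b z" using z b by simp
  qed
qed

section \<open>Integration against Lebesgue measure plus a point mass\<close>

text \<open>
  True for indicator functions by the definition of the measure, and preserved by the operations
  that generate all nonnegative measurable functions from them.
\<close>

lemma nn_integral_sum_measure:
  assumes sets: "sets N = sets M" and f: "f \<in> borel_measurable M"
  shows "(\<integral>\<^sup>+x. f x \<partial>sum_measure M N) = (\<integral>\<^sup>+x. f x \<partial>M) + (\<integral>\<^sup>+x. f x \<partial>N)"
  using f
proof (induction rule: borel_measurable_induct)
  have sp: "space N = space M" using sets by (rule sets_eq_imp_space_eq)
  have meas: "borel_measurable (sum_measure M N) = borel_measurable M" "borel_measurable N = borel_measurable M"
    using sets by (auto intro: measurable_cong_sets)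
  {
    case (cong f g)
    then have "(\<integral>\<^sup>+x. g x \<partial>L) = (\<integral>\<^sup>+x. f x \<partial>L)" if "space L = space M" for L
      using that by (intro nn_integral_cong) auto
    then show ?case using cong sp by simp
  next
    case (set A)
    then show ?case using sets by (simp add: emeasure_sum_measure)
  next
    case (mult u c)
    then show ?case by (simp add: meas nn_integral_cmult distrib_left)
  next
    case (add u v)
    then show ?case by (simp add: meas nn_integral_add ac_simps)
  next
    case (seq U)
    have sup: "Sup (range U) = (\<lambda>x. SUP i. U i x)"
      by (simp add: fun_eq_iff image_comp)
    have SUP_int: "(\<integral>\<^sup>+x. Sup (range U) x \<partial>L) = (SUP i. \<integral>\<^sup>+x. U i x \<partial>L)"
      if "borel_measurable L = (borel_measurable M :: ('a \<Rightarrow> ennreal) set)" for L :: "'a measure"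
      unfolding sup using seq that by (intro nn_integral_monotone_convergence_SUP) auto
    have "(SUP i. (\<integral>\<^sup>+x. U i x \<partial>M) + (\<integral>\<^sup>+x. U i x \<partial>N)) = (SUP i. \<integral>\<^sup>+x. U i x \<partial>M) + (SUP i. \<integral>\<^sup>+x. U i x \<partial>N)"
      using seq by (intro ennreal_SUP_add) (auto simp: incseq_def le_fun_def intro!: nn_integral_mono)
    then have "(\<integral>\<^sup>+x. Sup (range U) x \<partial>sum_measure M N)
        = (\<integral>\<^sup>+x. Sup (range U) x \<partial>M) + (\<integral>\<^sup>+x. Sup (range U) x \<partial>N)"
      using seq by (simp only: SUP_int meas)
    then show ?case using seq by simp
  }
qed

lemma borel_measurable_leb_dirac [simp]: "borel_measurable (leb_dirac S) = borel_measurable (lebesgue_on S)"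
  by (rule measurable_cong_sets) (simp_all add: leb_dirac_def)

lemma
  fixes h :: "real \<Rightarrow> real"
  assumes S: "0 \<in> S" and h: "h \<in> borel_measurable (lebesgue_on S)" and nn: "\<And>x. h x \<ge> 0"
  shows integrable_leb_dirac: "integrable (leb_dirac S) h \<longleftrightarrow> integrable (lebesgue_on S) h"
    and integral_leb_dirac: "integrable (lebesgue_on S) h \<Longrightarrow>
      (\<integral>x. h x \<partial>leb_dirac S) = (\<integral>x. h x \<partial>lebesgue_on S) + h 0"
proof -
  have [measurable]: "h \<in> borel_measurable (lebesgue_on S)" by (rule h)
  have nni: "(\<integral>\<^sup>+x. ennreal (h x) \<partial>leb_dirac S) = (\<integral>\<^sup>+x. ennreal (h x) \<partial>lebesgue_on S) + ennreal (h 0)"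
  proof -
    have "(\<integral>\<^sup>+x. ennreal (h x) \<partial>leb_dirac S)
        = (\<integral>\<^sup>+x. ennreal (h x) \<partial>lebesgue_on S) + (\<integral>\<^sup>+x. ennreal (h x) \<partial>return (lebesgue_on S) 0)"
      unfolding leb_dirac_def by (rule nn_integral_sum_measure) simp_all
    also have "(\<integral>\<^sup>+x. ennreal (h x) \<partial>return (lebesgue_on S) 0) = ennreal (h 0)"
      using S by (intro nn_integral_return) simp_all
    finally show ?thesis .
  qed
  show "integrable (leb_dirac S) h \<longleftrightarrow> integrable (lebesgue_on S) h"
    using nn h by (simp add: integrable_iff_bounded nni)
  assume int: "integrable (lebesgue_on S) h"
  have "(\<integral>\<^sup>+x. ennreal (h x) \<partial>lebesgue_on S) = ennreal (\<integral>x. h x \<partial>lebesgue_on S)"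
    using int nn by (intro nn_integral_eq_integral) auto
  then have "(\<integral>\<^sup>+x. ennreal (h x) \<partial>leb_dirac S) = ennreal ((\<integral>x. h x \<partial>lebesgue_on S) + h 0)"
    using nn by (simp add: nni ennreal_plus)
  then show "(\<integral>x. h x \<partial>leb_dirac S) = (\<integral>x. h x \<partial>lebesgue_on S) + h 0"
    using nn h by (subst integral_eq_nn_integral) (auto simp del: ennreal_plus)
qed

lemma Lp_fun_leb_dirac_iff:
  assumes "0 \<in> S"
  shows "f \<in> Lp_fun p (leb_dirac S) \<longleftrightarrow>
    f \<in> borel_measurable (lebesgue_on S) \<and> integrable (lebesgue_on S) (\<lambda>x. norm (f x) powr p)"
  using assms by (auto simp: Lp_fun_def integrable_leb_dirac)

lemma Lp_norm_leb_dirac: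
  assumes "0 \<in> S" "f \<in> Lp_fun p (leb_dirac S)"
  shows "Lp_norm p (leb_dirac S) f = ((\<integral>x. norm (f x) powr p \<partial>lebesgue_on S) + norm (f 0) powr p) powr (1 / p)"
  unfolding Lp_norm_def using assms by (subst integral_leb_dirac) (auto simp: Lp_fun_leb_dirac_iff)

lemma continuous_imp_Lp_fun_leb_dirac:
  fixes f :: "real \<Rightarrow> complex^'n"
  assumes "continuous_on {a..b} f" "0 \<in> {a..b}" "p > 0"
  shows "f \<in> Lp_fun p (leb_dirac {a..b})"
  unfolding Lp_fun_leb_dirac_iff[OF assms(2)]
proof
  show "f \<in> borel_measurable (lebesgue_on {a..b})"
    using assms by (intro continuous_imp_measurable_on_sets_lebesgue) auto
  show "integrable (lebesgue_on {a..b}) (\<lambda>x. norm (f x) powr p)"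
    using assms by (intro continuous_imp_integrable_real continuous_on_powr' continuous_intros) auto
qed

lemma Lp_subspace_continuous:
  assumes "0 \<in> {a..b}" "p > 0"
  shows "Lp_subspace p (leb_dirac {a..b}) {f :: real \<Rightarrow> complex^'n. continuous_on {a..b} f}"
  using assms unfolding Lp_subspace_def
  by (auto simp: vector_scalar_mult_def intro!: continuous_imp_Lp_fun_leb_dirac continuous_intros)

section \<open>Density of the continuous functions\<close>

lemma Lp_converges_of_integral:
  assumes "p > 0" "((\<lambda>i. \<integral>x. norm (u i x - f x) powr p \<partial>M) \<longlongrightarrow> 0) F"
  shows "Lp_converges p M u f F"
proof -
  have "((\<lambda>i. (\<integral>x. norm (u i x - f x) powr p \<partial>M) powr (1 / p)) \<longlongrightarrow> 0 powr (1 / p)) F"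
    using assms by (intro tendsto_powr' tendsto_const) auto
  then show ?thesis by (simp add: Lp_converges_def Lp_norm_def)
qed

text \<open>
  A diagonal argument: it suffices to approximate the members of a dense set \<open>T\<close>.
\<close>

lemma Lp_dense_trans:
  fixes S :: "('a \<Rightarrow> complex^'n) set"
  assumes p: "p \<ge> 1" and S: "S \<subseteq> Lp_fun p M" and T: "T \<subseteq> Lp_fun p M" "Lp_dense p M T"
    and approx: "\<And>f. f \<in> T \<Longrightarrow> \<exists>u. (\<forall>k. u k \<in> S) \<and> Lp_converges p M u f sequentially"
  shows "Lp_dense p M S"
  unfolding Lp_dense_def
proof
  fix f :: "'a \<Rightarrow> complex^'n" assume f: "f \<in> Lp_fun p M"
  obtain v where v: "\<And>k. v k \<in> T" "Lp_converges p M v f sequentially"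
    using T(2) f by (auto simp: Lp_dense_def)
  have "\<exists>u\<in>S. Lp_norm p M (\<lambda>x. u x - v k x) < inverse (real (Suc k))" for k
  proof -
    obtain u where u: "\<And>j. u j \<in> S" "Lp_converges p M u (v k) sequentially"
      using approx[OF v(1)] by blast
    have "\<forall>\<^sub>F j in sequentially. Lp_norm p M (\<lambda>x. u j x - v k x) < inverse (real (Suc k))"
      using u(2) unfolding Lp_converges_def by (rule order_tendstoD) simp
    then show ?thesis
      using u(1) by (auto simp: eventually_sequentially)
  qed
  then obtain u where u: "\<And>k. u k \<in> S" "\<And>k. Lp_norm p M (\<lambda>x. u k x - v k x) < inverse (real (Suc k))"
    by metis
  have "Lp_converges p M u f sequentially"
    unfolding Lp_converges_def
  proof (rule tendsto_sandwich[OF _ _ tendsto_const])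
    show "(\<lambda>k. 4 * (inverse (real (Suc k)) + Lp_norm p M (\<lambda>x. v k x - f x))) \<longlonglongrightarrow> 0"
      using tendsto_mult_left[OF tendsto_add[OF LIMSEQ_inverse_real_of_nat v(2)[unfolded Lp_converges_def]], of 4] by simp
    have "Lp_norm p M (\<lambda>x. u k x - f x) \<le> 4 * (inverse (real (Suc k)) + Lp_norm p M (\<lambda>x. v k x - f x))" for k
    proof -
      have "u k \<in> Lp_fun p M" "v k \<in> Lp_fun p M" using u(1) v(1) S T(1) by auto
      then have "Lp_norm p M (\<lambda>x. u k x - f x) \<le> 4 * (Lp_norm p M (\<lambda>x. u k x - v k x) + Lp_norm p M (\<lambda>x. f x - v k x))"
        using p f by (intro Lp_norm_diff_le)
      then show ?thesis
        using u(2)[of k] by (simp add: Lp_norm_minus_commute[of p M f "v k"])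
    qed
    then show "\<forall>\<^sub>F k in sequentially. Lp_norm p M (\<lambda>x. u k x - f x)
        \<le> 4 * (inverse (real (Suc k)) + Lp_norm p M (\<lambda>x. v k x - f x))"
      by (rule eventuallyI)
  qed auto
  then show "\<exists>u. (\<forall>k. u k \<in> S) \<and> Lp_converges p M u f sequentially"
    using u(1) by blast
qed

text \<open>
  Replace \<open>f\<close> by 0 where its norm exceeds \<open>k\<close>; the error is dominated by \<open>f\<close> itself and vanishes at
  each point for large \<open>k\<close>.
\<close>

lemma Lp_dense_bounded:
  assumes p: "p > 0"
  shows "Lp_dense p M {f \<in> Lp_fun p M. \<exists>c. \<forall>x. norm (f x) \<le> c}"
  unfolding Lp_dense_def
proof
  fix f :: "'a \<Rightarrow> complex^'n" assume f: "f \<in> Lp_fun p M"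
  then have [measurable]: "f \<in> borel_measurable M" and int: "integrable M (\<lambda>x. norm (f x) powr p)"
    by (auto simp: Lp_fun_def)
  define u where "u k x = (if norm (f x) \<le> real k then f x else 0)" for k x
  have [measurable]: "u k \<in> borel_measurable M" for k
    unfolding u_def by measurable
  have "integrable M (\<lambda>x. norm (u k x) powr p)" for k
    by (rule Bochner_Integration.integrable_bound[OF int]) (auto simp: u_def)
  then have "u k \<in> Lp_fun p M" for k by (simp add: Lp_fun_def)
  moreover have "norm (u k x) \<le> real k" for k x by (simp add: u_def)
  ultimately have mem: "u k \<in> {f \<in> Lp_fun p M. \<exists>c. \<forall>x. norm (f x) \<le> c}" for k by auto
  have "(\<lambda>k. \<integral>x. norm (u k x - f x) powr p \<partial>M) \<longlonglongrightarrow> (\<integral>x. 0 \<partial>M)"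
  proof (rule integral_dominated_convergence[where w = "\<lambda>x. norm (f x) powr p"])
    show "AE x in M. (\<lambda>k. norm (u k x - f x) powr p) \<longlonglongrightarrow> 0"
    proof (rule AE_I2)
      fix x
      obtain n where "norm (f x) \<le> real n" using real_arch_simple by blast
      then have "\<forall>\<^sub>F k in sequentially. norm (u k x - f x) powr p = 0"
        unfolding eventually_sequentially by (intro exI[of _ n]) (auto simp: u_def)
      then show "(\<lambda>k. norm (u k x - f x) powr p) \<longlonglongrightarrow> 0" by (rule tendsto_eventually)
    qed
    show "AE x in M. norm (norm (u k x - f x) powr p) \<le> norm (f x) powr p" for k
      by (rule AE_I2) (auto simp: u_def)
  qed (use int in auto)
  then have "Lp_converges p M u f sequentially"
    by (intro Lp_converges_of_integral p) simp
  then show "\<exists>u. (\<forall>k. u k \<in> {f \<in> Lp_fun p M. \<exists>c. \<forall>x. norm (f x) \<le> c}) \<and> Lp_converges p M u f sequentially"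
    using mem by blast
qed

text \<open>
  A Lebesgue measurable function is almost everywhere a limit of continuous functions \<open>g k\<close>. Two
  corrections turn this into convergence in the norm for Lebesgue measure plus a point mass at 0.
  The projection \<open>cl\<close> onto the ball of radius \<open>c\<close> makes the functions uniformly bounded without
  changing their limit, which lies in the ball. Adding the multiple by \<open>f 0 - cl (g k 0)\<close> of a spike
  \<open>\<beta> k\<close> of height 1 and width \<open>2 / k\<close> at 0 makes the approximation exact at the point mass; away
  from 0, the spike is eventually 0. Dominated convergence finishes the proof.
\<close>

lemma bounded_approx_by_continuous:
  fixes f :: "real \<Rightarrow> complex^'n"
  assumes ab: "0 \<in> {a..b}" and p: "p > 0"
    and f: "f \<in> borel_measurable (lebesgue_on {a..b})" and c: "\<And>x. norm (f x) \<le> c"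
  shows "\<exists>u. (\<forall>k. u k \<in> {f. continuous_on {a..b} f}) \<and> Lp_converges p (leb_dirac {a..b}) u f sequentially"
proof -
  have c0: "c \<ge> 0" using c[of 0] norm_ge_zero[of "f 0"] by linarith
  have "f measurable_on {a..b}"
    using f by (simp add: measurable_on_iff_borel_measurable)
  then obtain Z g where Z: "negligible Z" and g: "\<And>n. continuous_on UNIV (g n)"
    and lim_g: "\<And>x. x \<notin> Z \<Longrightarrow> (\<lambda>n. g n x) \<longlonglongrightarrow> (if x \<in> {a..b} then f x else 0)"
    unfolding measurable_on_def by blast
  define cl where "cl = closest_point (cball (0 :: complex^'n) c)"
  have ball: "convex (cball (0 :: complex^'n) c)" "closed (cball (0 :: complex^'n) c)" "cball (0 :: complex^'n) c \<noteq> {}"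
    using c0 by auto
  have cl_cont: "continuous_on UNIV cl"
    unfolding cl_def by (rule continuous_on_closest_point[OF ball])
  have cl_norm: "norm (cl v) \<le> c" for v
    using closest_point_in_set[OF ball(2,3), of v] by (simp add: cl_def)
  have cl_id: "cl (f x) = f x" for x
    unfolding cl_def using c by (intro closest_point_self) simp
  define \<beta> where "\<beta> k x = max 0 (1 - real k * \<bar>x\<bar>)" for k and x :: real
  have \<beta>: "0 \<le> \<beta> k x" "\<beta> k x \<le> 1" "\<beta> k 0 = 1" for k x by (auto simp: \<beta>_def)
  define u where "u k x = cl (g k x) + \<beta> k x *\<^sub>R (f 0 - cl (g k 0))" for k x
  have u0: "u k 0 = f 0" for k by (simp add: u_def \<beta>)
  have u_cont: "continuous_on {a..b} (u k)" for k
  proof -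
    have "continuous_on {a..b} (\<lambda>x. cl (g k x))"
      by (rule continuous_on_compose2[OF cl_cont continuous_on_subset[OF g]]) auto
    then show ?thesis
      unfolding u_def \<beta>_def by (intro continuous_intros)
  qed
  have u_lim: "(\<lambda>k. u k x) \<longlonglongrightarrow> f x" if x: "x \<in> {a..b}" "x \<notin> Z" "x \<noteq> 0" for x
  proof -
    have "(\<lambda>k. cl (g k x)) \<longlonglongrightarrow> cl (f x)"
      using lim_g[OF x(2)] x(1) cl_cont by (intro isCont_tendsto_compose[of _ cl]) (auto simp: continuous_on_eq_continuous_at)
    moreover have "(\<lambda>k. \<beta> k x *\<^sub>R (f 0 - cl (g k 0))) \<longlonglongrightarrow> 0"
    proof (rule tendsto_eventually)
      obtain n where n: "1 / \<bar>x\<bar> \<le> real n" using real_arch_simple by blast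
      have "\<beta> k x = 0" if "k \<ge> n" for k
      proof -
        have "1 / \<bar>x\<bar> \<le> real k" using n that by linarith
        then have "1 \<le> real k * \<bar>x\<bar>" using x(3) by (simp add: divide_le_eq)
        then show ?thesis by (simp add: \<beta>_def)
      qed
      then show "\<forall>\<^sub>F k in sequentially. \<beta> k x *\<^sub>R (f 0 - cl (g k 0)) = 0"
        by (auto simp: eventually_sequentially)
    qed
    ultimately show ?thesis
      using tendsto_add by (fastforce simp: u_def cl_id)
  qed
  have u_bound: "norm (u k x - f x) \<le> 4 * c" for k x
  proof -
    define w where "w = \<beta> k x *\<^sub>R (f 0 - cl (g k 0))"
    have "norm (f 0 - cl (g k 0)) \<le> c + c"
      using norm_triangle_ineq4[of "f 0" "cl (g k 0)"] c[of 0] cl_norm[of "g k 0"] by linarith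
    then have "norm w \<le> 1 * (c + c)"
      unfolding w_def norm_scaleR using \<beta>(1,2)[of k x] by (intro mult_mono) auto
    moreover have "norm (u k x - f x) \<le> norm (cl (g k x)) + norm w + norm (f x)"
      using norm_triangle_ineq4[of "cl (g k x) + w" "f x"] norm_triangle_ineq[of "cl (g k x)" w]
      by (simp add: u_def w_def)
    ultimately show ?thesis
      using c[of x] cl_norm[of "g k x"] by simp
  qed
  have [measurable]: "f \<in> borel_measurable (lebesgue_on {a..b})" by (rule f)
  have [measurable]: "u k \<in> borel_measurable (lebesgue_on {a..b})" for k
    by (intro continuous_imp_measurable_on_sets_lebesgue u_cont) simp
  have dom: "AE x in lebesgue_on {a..b}. norm (norm (u k x - f x) powr p) \<le> (4 * c) powr p" for k
    using u_bound p by (intro AE_I2) (auto intro!: powr_mono2)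
  have lim0: "AE x in lebesgue_on {a..b}. (\<lambda>k. norm (u k x - f x) powr p) \<longlonglongrightarrow> 0"
  proof -
    have "negligible (insert 0 Z)" using Z by simp
    then have "AE x in lebesgue. x \<notin> insert 0 Z"
      unfolding negligible_iff_null_sets by (rule AE_not_in)
    then have "AE x in lebesgue_on {a..b}. x \<notin> insert 0 Z"
      by (subst AE_restrict_space_iff) auto
    then show ?thesis
    proof (rule AE_mp, intro AE_I2 impI)
      fix x assume "x \<in> space (lebesgue_on {a..b})" "x \<notin> insert 0 Z"
      then have "(\<lambda>k. u k x) \<longlonglongrightarrow> f x" by (intro u_lim) auto
      then have "(\<lambda>k. norm (u k x - f x)) \<longlonglongrightarrow> 0"
        by (simp add: LIM_zero tendsto_norm_zero)
      then have "(\<lambda>k. norm (u k x - f x) powr p) \<longlonglongrightarrow> 0 powr p"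
        using p by (intro tendsto_powr' tendsto_const) auto
      then show "(\<lambda>k. norm (u k x - f x) powr p) \<longlonglongrightarrow> 0" by simp
    qed
  qed
  have "(\<lambda>k. \<integral>x. norm (u k x - f x) powr p \<partial>lebesgue_on {a..b}) \<longlonglongrightarrow> (\<integral>x. 0 \<partial>lebesgue_on {a..b})"
    by (rule integral_dominated_convergence[where w = "\<lambda>_. (4 * c) powr p", OF _ _ _ lim0 dom]) auto
  moreover have "(\<integral>x. norm (u k x - f x) powr p \<partial>leb_dirac {a..b}) = (\<integral>x. norm (u k x - f x) powr p \<partial>lebesgue_on {a..b})" for k
  proof -
    have "integrable (lebesgue_on {a..b}) (\<lambda>x. norm (u k x - f x) powr p)"
      by (rule integrable_dominated_convergence2[where w = "\<lambda>_. (4 * c) powr p", OF _ _ _ lim0 dom]) auto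
    then show ?thesis
      using integral_leb_dirac[OF ab, of "\<lambda>x. norm (u k x - f x) powr p"] by (simp add: u0)
  qed
  ultimately have "Lp_converges p (leb_dirac {a..b}) u f sequentially"
    using p by (intro Lp_converges_of_integral) simp_all
  then show ?thesis using u_cont by blast
qed

lemma Lp_dense_continuous:
  assumes ab: "0 \<in> {a..b}" and p: "p \<ge> 1"
  shows "Lp_dense p (leb_dirac {a..b}) {f :: real \<Rightarrow> complex^'n. continuous_on {a..b} f}"
proof (rule Lp_dense_trans[OF p _ _ Lp_dense_bounded])
  show "{f :: real \<Rightarrow> complex^'n. continuous_on {a..b} f} \<subseteq> Lp_fun p (leb_dirac {a..b})"
    using ab p by (auto intro!: continuous_imp_Lp_fun_leb_dirac)
  fix f :: "real \<Rightarrow> complex^'n"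
  assume "f \<in> {f \<in> Lp_fun p (leb_dirac {a..b}). \<exists>c. \<forall>x. norm (f x) \<le> c}"
  then obtain c where "f \<in> borel_measurable (lebesgue_on {a..b})" "\<And>x. norm (f x) \<le> c"
    using ab by (auto simp: Lp_fun_leb_dirac_iff)
  then show "\<exists>u. (\<forall>k. u k \<in> {f. continuous_on {a..b} f}) \<and> Lp_converges p (leb_dirac {a..b}) u f sequentially"
    using ab p by (intro bounded_approx_by_continuous) auto
qed (use p in auto)

section \<open>The bilinear form on continuous functions is bounded\<close>

text \<open>
  The scalar building block of the integral part of the form: the matrix case is a finite sum
  of such terms over the entries.
\<close>

definition RS_convolution_form ::
    "real \<Rightarrow> (real \<Rightarrow> complex) \<Rightarrow> (real \<Rightarrow> complex) \<Rightarrow> (real \<Rightarrow> complex) \<Rightarrow> complex" where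
  "RS_convolution_form r g \<psi> \<phi> =
     integral {-r..0} (\<lambda>\<xi>. RS_integral (-r) \<xi> (\<lambda>\<theta>. \<psi> (\<xi> - \<theta>)) g * \<phi> \<xi>)"

context
  fixes r :: real and g :: "real \<Rightarrow> complex" and V :: "real \<Rightarrow> real"
  assumes r: "r > 0" and V: "variation_bound V g (-r) 0"
begin

lemma RS_convolution_integrable:
  assumes "continuous_on {0..r} \<psi>" "continuous_on {-r..0} \<phi>"
  shows "(\<lambda>\<xi>. RS_integral (-r) \<xi> (\<lambda>\<theta>. \<psi> (\<xi> - \<theta>)) g * \<phi> \<xi>) integrable_on {-r..0}"
  by (rule RS_convolution_bound(1)[OF r V assms, of 2 2]) auto

lemma RS_convolution_form_add_left:
  assumes \<psi>: "continuous_on {0..r} \<psi>" "continuous_on {0..r} \<psi>'" and \<phi>: "continuous_on {-r..0} \<phi>"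
  shows "RS_convolution_form r g (\<lambda>x. \<psi> x + \<psi>' x) \<phi> = RS_convolution_form r g \<psi> \<phi> + RS_convolution_form r g \<psi>' \<phi>"
proof -
  have "RS_integral (-r) \<xi> (\<lambda>\<theta>. \<psi> (\<xi> - \<theta>) + \<psi>' (\<xi> - \<theta>)) g
      = RS_integral (-r) \<xi> (\<lambda>\<theta>. \<psi> (\<xi> - \<theta>)) g + RS_integral (-r) \<xi> (\<lambda>\<theta>. \<psi>' (\<xi> - \<theta>)) g"
    if "\<xi> \<in> {-r..0}" for \<xi>
    using that \<psi> V by (intro RS_integral_eq has_RS_integral_add has_RS_integral_convolution)
  then have "RS_convolution_form r g (\<lambda>x. \<psi> x + \<psi>' x) \<phi> = integral {-r..0}
      (\<lambda>\<xi>. RS_integral (-r) \<xi> (\<lambda>\<theta>. \<psi> (\<xi> - \<theta>)) g * \<phi> \<xi> + RS_integral (-r) \<xi> (\<lambda>\<theta>. \<psi>' (\<xi> - \<theta>)) g * \<phi> \<xi>)"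
    unfolding RS_convolution_form_def by (intro integral_cong) (simp add: distrib_right)
  also have "\<dots> = RS_convolution_form r g \<psi> \<phi> + RS_convolution_form r g \<psi>' \<phi>"
    unfolding RS_convolution_form_def
    using \<psi> \<phi> by (intro Henstock_Kurzweil_Integration.integral_add RS_convolution_integrable)
  finally show ?thesis .
qed

lemma RS_convolution_form_scale_left:
  assumes \<psi>: "continuous_on {0..r} \<psi>"
  shows "RS_convolution_form r g (\<lambda>x. c * \<psi> x) \<phi> = c * RS_convolution_form r g \<psi> \<phi>"
proof -
  have "RS_integral (-r) \<xi> (\<lambda>\<theta>. c * \<psi> (\<xi> - \<theta>)) g = c * RS_integral (-r) \<xi> (\<lambda>\<theta>. \<psi> (\<xi> - \<theta>)) g"
    if "\<xi> \<in> {-r..0}" for \<xi>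
    using that \<psi> V by (intro RS_integral_eq has_RS_integral_mult_left has_RS_integral_convolution)
  then have "RS_convolution_form r g (\<lambda>x. c * \<psi> x) \<phi> = integral {-r..0}
      (\<lambda>\<xi>. c * (RS_integral (-r) \<xi> (\<lambda>\<theta>. \<psi> (\<xi> - \<theta>)) g * \<phi> \<xi>))"
    unfolding RS_convolution_form_def by (intro integral_cong) simp
  then show ?thesis by (simp add: RS_convolution_form_def)
qed

lemma RS_convolution_form_add_right:
  assumes "continuous_on {0..r} \<psi>" "continuous_on {-r..0} \<phi>" "continuous_on {-r..0} \<phi>'"
  shows "RS_convolution_form r g \<psi> (\<lambda>x. \<phi> x + \<phi>' x) = RS_convolution_form r g \<psi> \<phi> + RS_convolution_form r g \<psi> \<phi>'"
  unfolding RS_convolution_form_def distrib_left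
  using assms by (intro Henstock_Kurzweil_Integration.integral_add RS_convolution_integrable)

lemma RS_convolution_form_scale_right:
  "RS_convolution_form r g \<psi> (\<lambda>x. c * \<phi> x) = c * RS_convolution_form r g \<psi> \<phi>"
  unfolding RS_convolution_form_def by (simp add: mult.left_commute)

end

lemma B_form_eq:
  fixes \<eta> :: "real \<Rightarrow> complex^'n^'n"
  assumes r: "r > 0" and V: "\<And>i j. variation_bound V (\<lambda>\<theta>. \<eta> \<theta> $ i $ j) (-r) 0"
    and \<psi>: "\<psi> \<in> C_star_space r" and \<phi>: "\<phi> \<in> C_space r"
  shows "B_form r \<eta> \<psi> \<phi> = row_times_col (\<psi> 0) (\<phi> 0) +
    (\<Sum>j\<in>UNIV. \<Sum>i\<in>UNIV. RS_convolution_form r (\<lambda>\<theta>. \<eta> \<theta> $ i $ j) (\<lambda>x. \<psi> x $ i) (\<lambda>x. \<phi> x $ j))"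
proof -
  have int: "(\<lambda>\<xi>. RS_integral (-r) \<xi> (\<lambda>\<theta>. \<psi> (\<xi> - \<theta>) $ i) (\<lambda>\<theta>. \<eta> \<theta> $ i $ j) * \<phi> \<xi> $ j) integrable_on {-r..0}" for i j
    using \<psi> \<phi> by (intro RS_convolution_integrable[OF r V]) (auto simp: C_star_space_def C_space_def intro!: continuous_intros)
  have "integral {-r..0} (\<lambda>\<xi>. row_times_col (RS_integral_row (-r) \<xi> (\<lambda>\<theta>. \<psi> (\<xi> - \<theta>)) \<eta>) (\<phi> \<xi>))
    = integral {-r..0} (\<lambda>\<xi>. \<Sum>j\<in>UNIV. \<Sum>i\<in>UNIV.
        RS_integral (-r) \<xi> (\<lambda>\<theta>. \<psi> (\<xi> - \<theta>) $ i) (\<lambda>\<theta>. \<eta> \<theta> $ i $ j) * \<phi> \<xi> $ j)"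
    by (simp add: row_times_col_def RS_integral_row_def sum_distrib_right)
  also have "\<dots> = (\<Sum>j\<in>UNIV. \<Sum>i\<in>UNIV. RS_convolution_form r (\<lambda>\<theta>. \<eta> \<theta> $ i $ j) (\<lambda>x. \<psi> x $ i) (\<lambda>x. \<phi> x $ j))"
    using int by (simp add: Henstock_Kurzweil_Integration.integral_sum integrable_sum RS_convolution_form_def)
  finally show ?thesis by (simp add: B_form_def)
qed

lemma norm_row_times_col_le: "norm (row_times_col x (y :: complex^'n)) \<le> real CARD('n) * (norm x * norm y)"
proof -
  have "norm (row_times_col x y) \<le> (\<Sum>i\<in>(UNIV :: 'n set). norm x * norm y)"
    unfolding row_times_col_def
    by (intro sum_norm_le) (simp add: norm_mult mult_mono Finite_Cartesian_Product.norm_nth_le)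
  then show ?thesis by simp
qed

lemma row_times_col_linear:
  "row_times_col (x + x') y = row_times_col x y + row_times_col x' y"
  "row_times_col x (y + y') = row_times_col x y + row_times_col x y'"
  "row_times_col (c *s x) y = c * row_times_col x y"
  "row_times_col x (c *s y) = c * row_times_col x y"
  by (simp_all add: row_times_col_def sum_distrib_left distrib_left distrib_right sum.distrib mult_ac)

text \<open>
  The point mass at 0 enters through the second inequality: it bounds the value at 0, and thus the
  term \<open>\<psi>(0)\<phi>(0)\<close> of the form, by the norm, although evaluation at a point is not continuous for
  the norm defined by Lebesgue measure alone.
\<close>

lemma component_norm_le_Lp_norm:
  fixes f :: "real \<Rightarrow> complex^'n"
  assumes f: "continuous_on {a..b} f" and ab: "0 \<in> {a..b}" and p: "p > 0"
  shows "(\<integral>x. norm (f x $ i) powr p \<partial>lebesgue_on {a..b}) powr (1 / p) \<le> Lp_norm p (leb_dirac {a..b}) f"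
    and "norm (f 0) \<le> Lp_norm p (leb_dirac {a..b}) f"
proof -
  have Lp: "f \<in> Lp_fun p (leb_dirac {a..b})"
    using assms by (intro continuous_imp_Lp_fun_leb_dirac)
  note norm_eq = Lp_norm_leb_dirac[OF ab Lp]
  have "(\<integral>x. norm (f x $ i) powr p \<partial>lebesgue_on {a..b}) \<le> (\<integral>x. norm (f x) powr p \<partial>lebesgue_on {a..b})"
  proof (rule integral_mono)
    show "integrable (lebesgue_on {a..b}) (\<lambda>x. norm (f x $ i) powr p)"
      using f p by (intro continuous_imp_integrable_real continuous_on_powr' continuous_intros) auto
    show "integrable (lebesgue_on {a..b}) (\<lambda>x. norm (f x) powr p)"
      using Lp Lp_fun_leb_dirac_iff[OF ab] by blast
    show "norm (f x $ i) powr p \<le> norm (f x) powr p" for x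
      using p by (intro powr_mono2) (auto simp: Finite_Cartesian_Product.norm_nth_le)
  qed
  also have "\<dots> \<le> (\<integral>x. norm (f x) powr p \<partial>lebesgue_on {a..b}) + norm (f 0) powr p"
    by simp
  finally show "(\<integral>x. norm (f x $ i) powr p \<partial>lebesgue_on {a..b}) powr (1 / p) \<le> Lp_norm p (leb_dirac {a..b}) f"
    unfolding norm_eq using p by (intro powr_mono2) auto
  have "norm (f 0) = (norm (f 0) powr p) powr (1 / p)"
    using p by (simp add: powr_powr)
  also have "\<dots> \<le> Lp_norm p (leb_dirac {a..b}) f"
    unfolding norm_eq using p by (intro powr_mono2) auto
  finally show "norm (f 0) \<le> Lp_norm p (leb_dirac {a..b}) f" .
qed

lemma B_form_bound:
  fixes \<eta> :: "real \<Rightarrow> complex^'n^'n"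
  assumes r: "r > 0" and V: "\<And>i j. variation_bound V (\<lambda>\<theta>. \<eta> \<theta> $ i $ j) (-r) 0"
    and pq: "1 < p" "1 < q" "1 / p + 1 / q = 1"
    and \<psi>: "\<psi> \<in> C_star_space r" and \<phi>: "\<phi> \<in> C_space r"
  shows "norm (B_form r \<eta> \<psi> \<phi>) \<le> (real CARD('n) + real CARD('n) * real CARD('n) * (V 0 - V (-r)))
    * Lp_norm q (m_star_meas r) \<psi> * Lp_norm p (m_meas r) \<phi>"
proof -
  let ?W = "V 0 - V (-r)" and ?N = "real CARD('n)"
  define A B where "A = Lp_norm q (m_star_meas r) \<psi>" and "B = Lp_norm p (m_meas r) \<phi>"
  have AB: "A \<ge> 0" "B \<ge> 0" by (simp_all add: A_def B_def)
  have c: "continuous_on {0..r} \<psi>" "continuous_on {-r..0} \<phi>"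
    using \<psi> \<phi> by (auto simp: C_star_space_def C_space_def)
  have W: "?W \<ge> 0" using variation_bound_mono[OF V, of "-r" 0] r by simp
  have at0: "norm (\<psi> 0) \<le> A" "norm (\<phi> 0) \<le> B"
    unfolding A_def B_def m_star_meas_def m_meas_def
    using c r pq by (auto intro!: component_norm_le_Lp_norm(2))
  have 1: "norm (row_times_col (\<psi> 0) (\<phi> 0)) \<le> ?N * (A * B)"
    by (rule order_trans[OF norm_row_times_col_le]) (use at0 AB in \<open>auto intro!: mult_mono\<close>)
  have conv: "norm (RS_convolution_form r (\<lambda>\<theta>. \<eta> \<theta> $ i $ j) (\<lambda>x. \<psi> x $ i) (\<lambda>x. \<phi> x $ j)) \<le> ?W * (A * B)" for i j
  proof -
    have "norm (RS_convolution_form r (\<lambda>\<theta>. \<eta> \<theta> $ i $ j) (\<lambda>x. \<psi> x $ i) (\<lambda>x. \<phi> x $ j)) \<le> ?W *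
      ((\<integral>x. norm (\<psi> x $ i) powr q \<partial>lebesgue_on {0..r}) powr (1 / q) *
       (\<integral>x. norm (\<phi> x $ j) powr p \<partial>lebesgue_on {-r..0}) powr (1 / p))"
      unfolding RS_convolution_form_def
      using c pq by (intro RS_convolution_bound(2)[OF r V] continuous_intros)
    also have "\<dots> \<le> ?W * (A * B)"
      unfolding A_def B_def m_star_meas_def m_meas_def
      using c r pq W by (intro mult_left_mono mult_mono component_norm_le_Lp_norm(1)) auto
    finally show ?thesis .
  qed
  have 2: "norm (\<Sum>j\<in>UNIV. \<Sum>i\<in>UNIV. RS_convolution_form r (\<lambda>\<theta>. \<eta> \<theta> $ i $ j) (\<lambda>x. \<psi> x $ i) (\<lambda>x. \<phi> x $ j))
      \<le> (\<Sum>j\<in>(UNIV :: 'n set). \<Sum>i\<in>(UNIV :: 'n set). ?W * (A * B))"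
    by (intro sum_norm_le conv)
  have "norm (B_form r \<eta> \<psi> \<phi>) \<le> ?N * (A * B) + (\<Sum>j\<in>(UNIV :: 'n set). \<Sum>i\<in>(UNIV :: 'n set). ?W * (A * B))"
    unfolding B_form_eq[OF r V \<psi> \<phi>] by (rule norm_triangle_le[OF add_mono[OF 1 2]])
  also have "\<dots> = (?N + ?N * ?N * ?W) * A * B"
    by (simp add: algebra_simps)
  finally show ?thesis by (simp only: A_def B_def)
qed

text \<open>
  A variation function of the matrix-valued \<open>\<eta>\<close> works for each entry, so one \<open>V\<close> serves all
  terms of the form.
\<close>

lemma dense_bounded_bilinear_B_form:
  fixes \<eta> :: "real \<Rightarrow> complex^'n^'n"
  assumes r: "r > 0" and \<eta>: "bounded_variation_on {-r..0} \<eta>"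
    and pq: "1 < p" "1 < q" "1 / p + 1 / q = 1"
  shows "\<exists>K. dense_bounded_bilinear q p (m_star_meas r) (m_meas r) (C_star_space r) (C_space r) (B_form r \<eta>) K"
proof -
  obtain V where V0: "variation_bound V \<eta> (-r) 0"
    using bounded_variation_imp_variation_bound[OF \<eta>] by blast
  have V: "variation_bound V (\<lambda>\<theta>. \<eta> \<theta> $ i $ j) (-r) 0" for i j
    unfolding variation_bound_def
  proof (intro allI impI)
    fix x y assume xy: "-r \<le> x" "x \<le> y" "y \<le> 0"
    have "norm ((\<eta> y - \<eta> x) $ i $ j) \<le> norm (\<eta> y - \<eta> x)"
      by (meson Finite_Cartesian_Product.norm_nth_le order_trans)
    then show "norm (\<eta> y $ i $ j - \<eta> x $ i $ j) \<le> V y - V x"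
      using variation_boundD[OF V0 xy] by simp
  qed
  have sub: "Lp_subspace q (m_star_meas r) (C_star_space r :: (real \<Rightarrow> complex^'n) set)"
    "Lp_subspace p (m_meas r) (C_space r :: (real \<Rightarrow> complex^'n) set)"
    unfolding m_star_meas_def m_meas_def C_star_space_def C_space_def
    using r pq by (auto intro!: Lp_subspace_continuous)
  have dense: "Lp_dense q (m_star_meas r) (C_star_space r :: (real \<Rightarrow> complex^'n) set)"
    "Lp_dense p (m_meas r) (C_space r :: (real \<Rightarrow> complex^'n) set)"
    unfolding m_star_meas_def m_meas_def C_star_space_def C_space_def
    using r pq by (auto intro!: Lp_dense_continuous)
  note eq = B_form_eq[OF r V]
  note clos = Lp_subspaceD(2,3)[OF sub(1)] Lp_subspaceD(2,3)[OF sub(2)]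
  have comp: "continuous_on {0..r} (\<lambda>x. \<psi> x $ i)" if "\<psi> \<in> C_star_space r" for \<psi> :: "real \<Rightarrow> complex^'n" and i
    using that by (auto simp: C_star_space_def intro!: continuous_intros)
  have comp': "continuous_on {-r..0} (\<lambda>x. \<phi> x $ i)" if "\<phi> \<in> C_space r" for \<phi> :: "real \<Rightarrow> complex^'n" and i
    using that by (auto simp: C_space_def intro!: continuous_intros)
  have "dense_bounded_bilinear q p (m_star_meas r) (m_meas r) (C_star_space r) (C_space r) (B_form r \<eta>)
    (real CARD('n) + real CARD('n) * real CARD('n) * (V 0 - V (-r)))"
  proof
    fix \<psi> \<psi>' \<phi> :: "real \<Rightarrow> complex^'n"
    assume "\<psi> \<in> C_star_space r" "\<psi>' \<in> C_star_space r" "\<phi> \<in> C_space r"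
    then show "B_form r \<eta> (\<lambda>x. \<psi> x + \<psi>' x) \<phi> = B_form r \<eta> \<psi> \<phi> + B_form r \<eta> \<psi>' \<phi>"
      by (simp add: eq clos row_times_col_linear comp comp' RS_convolution_form_add_left[OF r V] sum.distrib)
  next
    fix c and \<psi> \<phi> :: "real \<Rightarrow> complex^'n"
    assume "\<psi> \<in> C_star_space r" "\<phi> \<in> C_space r"
    then show "B_form r \<eta> (\<lambda>x. c *s \<psi> x) \<phi> = c * B_form r \<eta> \<psi> \<phi>"
      "B_form r \<eta> \<psi> (\<lambda>x. c *s \<phi> x) = c * B_form r \<eta> \<psi> \<phi>"
      by (simp_all add: eq clos row_times_col_linear comp comp' RS_convolution_form_scale_left[OF r V]
          RS_convolution_form_scale_right[OF r V] distrib_left sum_distrib_left)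
    show "norm (B_form r \<eta> \<psi> \<phi>) \<le> (real CARD('n) + real CARD('n) * real CARD('n) * (V 0 - V (-r)))
      * Lp_norm q (m_star_meas r) \<psi> * Lp_norm p (m_meas r) \<phi>"
      by (rule B_form_bound[OF r V pq]) fact+
  next
    fix \<psi> \<phi> \<phi>' :: "real \<Rightarrow> complex^'n"
    assume "\<psi> \<in> C_star_space r" "\<phi> \<in> C_space r" "\<phi>' \<in> C_space r"
    then show "B_form r \<eta> \<psi> (\<lambda>x. \<phi> x + \<phi>' x) = B_form r \<eta> \<psi> \<phi> + B_form r \<eta> \<psi> \<phi>'"
      by (simp add: eq clos row_times_col_linear comp comp' RS_convolution_form_add_right[OF r V] sum.distrib)
  next
    show "0 \<le> real CARD('n) + real CARD('n) * real CARD('n) * (V 0 - V (-r))"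
      using variation_bound_mono[OF V0, of "-r" 0] r by simp
  qed (use pq sub dense in auto)
  then show ?thesis ..
qed

theorem theorem5p3:
  fixes r p q :: real and \<eta> :: "real \<Rightarrow> complex^'n^'n"
  assumes "r > 0"
    and "bounded_variation_on {-r..0} \<eta>"
    and "1 < p"
    and "1 / p + 1 / q = 1"
  shows "\<exists>!b. b \<in> (points (M_star r q) \<times> points (Mp r p)) \<rightarrow>\<^sub>E (UNIV :: complex set)
           \<and> bilinear_form (M_star r q) (Mp r p) b
           \<and> bounded_form (M_star r q) (Mp r p) b
           \<and> (\<forall>\<psi>\<in>C_star_space r. \<forall>\<phi>\<in>C_space r.
                b (Lp_class q (m_star_meas r) \<psi>, Lp_class p (m_meas r) \<phi>) = B_form r \<eta> \<psi> \<phi>)"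
proof -
  have "0 < 1 / p" "1 / p < 1"
    using assms(3) by simp_all
  then have "0 < 1 / q" "1 / q < 1"
    using assms(4) by linarith+
  then have "q > 1"
    by (simp add: divide_less_eq)
  then obtain K where
    "dense_bounded_bilinear q p (m_star_meas r) (m_meas r) (C_star_space r) (C_space r) (B_form r \<eta>) K"
    using dense_bounded_bilinear_B_form[OF assms(1-3) _ assms(4)] by blast
  then show ?thesis
    unfolding M_star_def Mp_def by (rule dense_bounded_bilinear.unique_extension)
qed

end
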